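(* Let $X$ be a weighted pure $n$-dimensional finite simplicial complex that is a two-sided $\lambda$-local-spectral expander, and define constants $\varepsilon_k$, $0\le k\le n-1$, by $\varepsilon_0=\lambda$ and $\varepsilon_k=2k(1+2k\sqrt{k})\varepsilon_{k-1}+(k+1)\lambda$ for $k>0$. Suppose $\varepsilon_k\le\frac{1}{2(1+2(k+1)\sqrt{k+1})}$ for all $0\le k\le n-2$ and $\varepsilon_{n-1}<\frac{1}{2\sqrt n}$. Then for every $0\le k\le n-1$, $$\operatorname{Spec}(M_k^+)\subseteq\{1\}\cup\bigcup_{j=0}^k\left[\frac{k+1-j}{k+2}-\frac{\sqrt{k+1}}{k+2}\varepsilon_k,\ \frac{k+1-j}{k+2}+\frac{\sqrt{k+1}}{k+2}\varepsilon_k\right].$$ Moreover, for every $\phi\in C_0^k(X)$ with $M_k^+\phi=\mu\phi$ and every $0\le j\le k$, if $\mu\in\left[\frac{k+1-j}{k+2}-\frac{\sqrt{k+1}}{k+2}\varepsilon_k,\ \frac{k+1-j}{k+2}+\frac{\sqrt{k+1}}{k+2}\varepsilon_k\right]$, then $$\|\phi-P_{U_k^j}\phi\|\le\frac{\sqrt{k+1}\,\varepsilon_k}{1-\sqrt{k+1}\,\varepsilon_k}\|\phi\|.$$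
   Context: A finite simplicial complex $X$ is pure $n$-dimensional ($n\ge1$) if every simplex is contained in an $n$-dimensional simplex. $X(k)$ is the set of $k$-dimensional simplices, with $X(-1)=\{\emptyset\}$. A weight function is a map $m:\bigcup_{-1\le k\le n}X(k)\to(0,\infty)$ with $m(\tau)=\sum_{\sigma\in X(k+1),\,\tau\subset\sigma}m(\sigma)$ for all $-1\le k\le n-1$, $\tau\in X(k)$. $C^k(X)$ is the space of all functions $X(k)\to\mathbb{R}$ with inner product $\langle\phi,\psi\rangle=\sum_{\sigma\in X(k)}m(\sigma)\phi(\sigma)\psi(\sigma)$ and norm $\|\cdot\|$. $C_0^k(X)=\{\phi\in C^k(X):\sum_{\sigma\in X(k)}m(\sigma)\phi(\sigma)=0\}$. Signless differential: $d_k:C^k(X)\to C^{k+1}(X)$, $d_k\phi(\sigma)=\sum_{\tau\in X(k),\,\tau\subset\sigma}\phi(\tau)$, with adjoint $d_k^*$. For $0\le k\le n-1$ the upper random walk operator $M_k^+$ on $C^k(X)$ is $M_k^+\phi(\tau)=\sum_{\tau'\in X(k)}M_k^+(\tau,\tau')\phi(\tau')$, where $M_k^+(\tau,\tau)=\frac1{k+2}$, $M_k^+(\tau,\tau')=\frac{m(\tau\cup\tau')}{(k+2)m(\tau)}$ if $\tau\cup\tau'\in X(k+1)$, and $0$ otherwise. $\operatorname{Spec}$ denotes the set of eigenvalues. Subspaces of $C_0^k(X)$: $V_0^0=C_0^0(X)$; for $1\le k\le n-1$, $V_k^j=d_{k-1}\cdots d_j(C_0^j(X))$ for $0\le j\le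 k-1$, and $V_k^k=\ker(d_{k-1}^* )$, which is the orthogonal complement of $V_k^{k-1}$ in $C_0^k(X)$. Set $U_k^0=V_k^0$, $U_k^j=V_k^j\cap(V_k^{j-1})^\perp$ for $1\le j\le k-1$, and $U_k^k=V_k^k$. Then $C_0^k(X)=U_k^0\oplus\dots\oplus U_k^k$ orthogonally. $P_U$ denotes orthogonal projection onto $U$. For $\tau\in X(i)$, $-1\le i\le n-2$, the link $X_\tau$ is the complex of all simplices $\eta$ disjoint from $\tau$ with $\tau\cup\eta\in X$, with weight $m_\tau(\eta)=m(\tau\cup\eta)$. The non-lazy walk operator on functions $f$ on the vertices of $X_\tau$ is $f\mapsto\left(v\mapsto\sum_{w:\{v,w\}\in X_\tau(1)}\frac{m_\tau(\{v,w\})}{m_\tau(\{v\})}f(w)\right)$; it is self-adjoint with largest eigenvalue $1$; $\mu_\tau$ is its second largest eigenvalue (counted with multiplicity) and $\nu_\tau$ its smallest. $X$ is a two-sided $\lambda$-local-spectral expander if $-\lambda\le\nu_\tau$ and $\mu_\tau\le\lambda$ for every $\tau\in X(i)$, $-1\le i\le n-2$. *)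

theory Defs
  imports "HOL-Analysis.Analysis" "HOL-Library.Function_Algebras" "HOL-Library.Multiset"
begin

section \<open>Functions on a set, eigenvalues, multiplicities\<close>

text \<open>A function on a set \<open>A\<close> is represented by its extension by zero. Linear structure on
  function types is pointwise.\<close>

definition fun_on :: "'b set \<Rightarrow> ('b \<Rightarrow> real) set" where
  "fun_on A = {f. \<forall>x. x \<notin> A \<longrightarrow> f x = 0}"

definition fscale :: "real \<Rightarrow> ('b \<Rightarrow> real) \<Rightarrow> 'b \<Rightarrow> real" where
  "fscale c f = (\<lambda>x. c * f x)"

interpretation fs: vector_space "fscale :: real \<Rightarrow> ('b \<Rightarrow> real) \<Rightarrow> 'b \<Rightarrow> real"
  by unfold_locales (auto simp: fscale_def fun_eq_iff algebra_simps)

definition eigenspace ::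
  "('b \<Rightarrow> real) set \<Rightarrow> (('b \<Rightarrow> real) \<Rightarrow> 'b \<Rightarrow> real) \<Rightarrow> real \<Rightarrow> ('b \<Rightarrow> real) set" where
  "eigenspace W T c = {f \<in> W. T f = fscale c f}"

definition Spec :: "('b \<Rightarrow> real) set \<Rightarrow> (('b \<Rightarrow> real) \<Rightarrow> 'b \<Rightarrow> real) \<Rightarrow> real set" where
  "Spec W T = {c. \<exists>f \<in> W. f \<noteq> 0 \<and> T f = fscale c f}"

text \<open>Meant for self-adjoint \<open>T\<close> on finite-dimensional \<open>W\<close>, where the geometric and algebraic
  multiplicities of an eigenvalue agree.\<close>

definition Spec_mset :: "('b \<Rightarrow> real) set \<Rightarrow> (('b \<Rightarrow> real) \<Rightarrow> 'b \<Rightarrow> real) \<Rightarrow> real multiset" where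
  "Spec_mset W T = (\<Sum>c\<in>Spec W T. replicate_mset (fs.dim (eigenspace W T c)) c)"

definition second_largest_eigenvalue ::
  "('b \<Rightarrow> real) set \<Rightarrow> (('b \<Rightarrow> real) \<Rightarrow> 'b \<Rightarrow> real) \<Rightarrow> real" where
  "second_largest_eigenvalue W T = rev (sorted_list_of_multiset (Spec_mset W T)) ! 1"

definition smallest_eigenvalue ::
  "('b \<Rightarrow> real) set \<Rightarrow> (('b \<Rightarrow> real) \<Rightarrow> 'b \<Rightarrow> real) \<Rightarrow> real" where
  "smallest_eigenvalue W T = Min (Spec W T)"


section \<open>Weighted simplicial complexes\<close>

text \<open>A complex is the set of all its simplices, the empty simplex included. Dimensions of faces
  are integers, so that \<open>faces X (-1)\<close> is \<open>{{}}\<close>.\<close>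

definition abstract_simplicial_complex :: "'a set set \<Rightarrow> bool" where
  "abstract_simplicial_complex X \<longleftrightarrow>
     X \<noteq> {} \<and> finite X \<and> (\<forall>\<sigma>\<in>X. finite \<sigma>) \<and> (\<forall>\<sigma>\<in>X. \<forall>\<tau>. \<tau> \<subseteq> \<sigma> \<longrightarrow> \<tau> \<in> X)"

definition faces :: "'a set set \<Rightarrow> int \<Rightarrow> 'a set set" where
  "faces X k = {\<sigma> \<in> X. int (card \<sigma>) = k + 1}"

definition pure_complex :: "nat \<Rightarrow> 'a set set \<Rightarrow> bool" where
  "pure_complex n X \<longleftrightarrow> (\<forall>\<sigma>\<in>X. \<exists>\<rho>\<in>faces X (int n). \<sigma> \<subseteq> \<rho>)"

definition weight_function :: "nat \<Rightarrow> 'a set set \<Rightarrow> ('a set \<Rightarrow> real) \<Rightarrow> bool" where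
  "weight_function n X m \<longleftrightarrow>
     (\<forall>k\<in>{-1..int n}. \<forall>\<sigma>\<in>faces X k. 0 < m \<sigma>) \<and>
     (\<forall>k\<in>{-1..int n - 1}. \<forall>\<tau>\<in>faces X k. m \<tau> = (\<Sum>\<sigma> | \<sigma> \<in> faces X (k + 1) \<and> \<tau> \<subset> \<sigma>. m \<sigma>))"

definition link :: "'a set set \<Rightarrow> 'a set \<Rightarrow> 'a set set" where
  "link X \<tau> = {\<eta> \<in> X. \<eta> \<inter> \<tau> = {} \<and> \<tau> \<union> \<eta> \<in> X}"

definition link_weight :: "('a set \<Rightarrow> real) \<Rightarrow> 'a set \<Rightarrow> 'a set \<Rightarrow> real" where
  "link_weight m \<tau> \<eta> = m (\<tau> \<union> \<eta>)"

definition vertices :: "'a set set \<Rightarrow> 'a set" where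
  "vertices X = {v. {v} \<in> faces X 0}"

definition nonlazy_walk :: "'a set set \<Rightarrow> ('a set \<Rightarrow> real) \<Rightarrow> ('a \<Rightarrow> real) \<Rightarrow> 'a \<Rightarrow> real" where
  "nonlazy_walk X m f = (\<lambda>v. if v \<in> vertices X
     then (\<Sum>w | {v, w} \<in> faces X 1. m {v, w} / m {v} * f w) else 0)"

definition two_sided_local_spectral_expander ::
  "nat \<Rightarrow> 'a set set \<Rightarrow> ('a set \<Rightarrow> real) \<Rightarrow> real \<Rightarrow> bool" where
  "two_sided_local_spectral_expander n X m l \<longleftrightarrow>
     (\<forall>i\<in>{-1..int n - 2}. \<forall>\<tau>\<in>faces X i.
        let W = fun_on (vertices (link X \<tau>)); T = nonlazy_walk (link X \<tau>) (link_weight m \<tau>)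
        in - l \<le> smallest_eigenvalue W T \<and> second_largest_eigenvalue W T \<le> l)"


section \<open>Cochains\<close>

definition cochains :: "'a set set \<Rightarrow> nat \<Rightarrow> ('a set \<Rightarrow> real) set" where
  "cochains X k = fun_on (faces X (int k))"

definition cinner :: "'a set set \<Rightarrow> ('a set \<Rightarrow> real) \<Rightarrow> nat \<Rightarrow>
    ('a set \<Rightarrow> real) \<Rightarrow> ('a set \<Rightarrow> real) \<Rightarrow> real" where
  "cinner X m k \<phi> \<psi> = (\<Sum>\<sigma>\<in>faces X (int k). m \<sigma> * \<phi> \<sigma> * \<psi> \<sigma>)"

definition cnorm :: "'a set set \<Rightarrow> ('a set \<Rightarrow> real) \<Rightarrow> nat \<Rightarrow> ('a set \<Rightarrow> real) \<Rightarrow> real" where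
  "cnorm X m k \<phi> = sqrt (cinner X m k \<phi> \<phi>)"

definition cochains0 :: "'a set set \<Rightarrow> ('a set \<Rightarrow> real) \<Rightarrow> nat \<Rightarrow> ('a set \<Rightarrow> real) set" where
  "cochains0 X m k = {\<phi> \<in> cochains X k. (\<Sum>\<sigma>\<in>faces X (int k). m \<sigma> * \<phi> \<sigma>) = 0}"

definition dsl :: "'a set set \<Rightarrow> nat \<Rightarrow> ('a set \<Rightarrow> real) \<Rightarrow> 'a set \<Rightarrow> real" where
  "dsl X k \<phi> = (\<lambda>\<sigma>. if \<sigma> \<in> faces X (int k + 1)
     then (\<Sum>\<tau> | \<tau> \<in> faces X (int k) \<and> \<tau> \<subset> \<sigma>. \<phi> \<tau>) else 0)"

text \<open>The adjoint of \<open>dsl X k\<close> with respect to the weighted inner products; the extensional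
  function space makes the description unique.\<close>

definition dsl_adj :: "'a set set \<Rightarrow> ('a set \<Rightarrow> real) \<Rightarrow> nat \<Rightarrow>
    ('a set \<Rightarrow> real) \<Rightarrow> 'a set \<Rightarrow> real" where
  "dsl_adj X m k = (THE T. T \<in> cochains X (k + 1) \<rightarrow>\<^sub>E cochains X k \<and>
     (\<forall>\<phi>\<in>cochains X k. \<forall>\<psi>\<in>cochains X (k + 1).
        cinner X m (k + 1) (dsl X k \<phi>) \<psi> = cinner X m k \<phi> (T \<psi>)))"

text \<open>\<open>dsl_iter X j l\<close> is the composite of \<open>dsl X (j + l - 1)\<close>, ..., \<open>dsl X j\<close>.\<close>

primrec dsl_iter :: "'a set set \<Rightarrow> nat \<Rightarrow> nat \<Rightarrow> ('a set \<Rightarrow> real) \<Rightarrow> 'a set \<Rightarrow> real" where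
  "dsl_iter X j 0 \<phi> = \<phi>"
| "dsl_iter X j (Suc l) \<phi> = dsl X (j + l) (dsl_iter X j l \<phi>)"

definition upper_walk_kernel :: "'a set set \<Rightarrow> ('a set \<Rightarrow> real) \<Rightarrow> nat \<Rightarrow> 'a set \<Rightarrow> 'a set \<Rightarrow> real" where
  "upper_walk_kernel X m k \<tau> \<tau>' =
     (if \<tau> = \<tau>' then 1 / (real k + 2)
      else if \<tau> \<union> \<tau>' \<in> faces X (int k + 1) then m (\<tau> \<union> \<tau>') / ((real k + 2) * m \<tau>)
      else 0)"

definition upper_walk :: "'a set set \<Rightarrow> ('a set \<Rightarrow> real) \<Rightarrow> nat \<Rightarrow>
    ('a set \<Rightarrow> real) \<Rightarrow> 'a set \<Rightarrow> real" where
  "upper_walk X m k \<phi> = (\<lambda>\<tau>. if \<tau> \<in> faces X (int k)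
     then (\<Sum>\<tau>'\<in>faces X (int k). upper_walk_kernel X m k \<tau> \<tau>' * \<phi> \<tau>') else 0)"


section \<open>The orthogonal decomposition\<close>

definition orth_compl :: "'a set set \<Rightarrow> ('a set \<Rightarrow> real) \<Rightarrow> nat \<Rightarrow>
    ('a set \<Rightarrow> real) set \<Rightarrow> ('a set \<Rightarrow> real) set" where
  "orth_compl X m k W = {\<phi> \<in> cochains X k. \<forall>\<psi>\<in>W. cinner X m k \<phi> \<psi> = 0}"

definition orth_proj :: "'a set set \<Rightarrow> ('a set \<Rightarrow> real) \<Rightarrow> nat \<Rightarrow>
    ('a set \<Rightarrow> real) set \<Rightarrow> ('a set \<Rightarrow> real) \<Rightarrow> 'a set \<Rightarrow> real" where
  "orth_proj X m k W \<phi> = (THE \<psi>. \<psi> \<in> W \<and> (\<forall>\<theta>\<in>W. cinner X m k (\<phi> - \<psi>) \<theta> = 0))"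

text \<open>\<open>Vsp X m k j\<close> and \<open>Usp X m k j\<close> are the spaces \<open>V\<^sub>k\<^sup>j\<close> and \<open>U\<^sub>k\<^sup>j\<close>; they are only meaningful
  for \<open>j \<le> k\<close>.\<close>

definition Vsp :: "'a set set \<Rightarrow> ('a set \<Rightarrow> real) \<Rightarrow> nat \<Rightarrow> nat \<Rightarrow> ('a set \<Rightarrow> real) set" where
  "Vsp X m k j =
     (if j < k then dsl_iter X j (k - j) ` cochains0 X m j
      else if k = 0 then cochains0 X m 0
      else {\<phi> \<in> cochains X k. dsl_adj X m (k - 1) \<phi> = 0})"

definition Usp :: "'a set set \<Rightarrow> ('a set \<Rightarrow> real) \<Rightarrow> nat \<Rightarrow> nat \<Rightarrow> ('a set \<Rightarrow> real) set" where
  "Usp X m k j =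
     (if j = 0 \<or> j = k then Vsp X m k j
      else Vsp X m k j \<inter> orth_compl X m k (Vsp X m k (j - 1)))"


section \<open>The error terms\<close>

primrec eps :: "real \<Rightarrow> nat \<Rightarrow> real" where
  "eps l 0 = l"
| "eps l (Suc k) = 2 * real (Suc k) * (1 + 2 * real (Suc k) * sqrt (real (Suc k))) * eps l k
     + (real (Suc k) + 1) * l"

definition eps_interval :: "real \<Rightarrow> nat \<Rightarrow> nat \<Rightarrow> real set" where
  "eps_interval l k j =
     {(real k + 1 - real j) / (real k + 2) - sqrt (real k + 1) / (real k + 2) * eps l k ..
      (real k + 1 - real j) / (real k + 2) + sqrt (real k + 1) / (real k + 2) * eps l k}"

end

theory Submission
  imports Defs
begin

text \<open>
  Up to the factor \<open>k + 2\<close>, the upper walk on \<open>k\<close>-cochains is the upper Laplacian \<open>lap = dn \<circ> up\<close>, where \<open>up\<close> is the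
  signless differential and \<open>dn\<close> its adjoint (lemma \<open>upper_walk_eq\<close>). The theorem says that \<open>lap\<close> is nearly the
  integer \<open>k + 1 - j\<close> on the \<open>j\<close>-th summand \<open>Usp X m k j\<close> of the mean-zero cochains, with error \<open>eps l k\<close>; once
  this is known (lemma \<open>approx_spectrum_eps\<close>), an eigenvector is split into its components. The errors add up to
  at most \<open>\<delta> = sqrt (k + 1) * eps l k\<close>, so the eigenvalue is \<open>\<delta>\<close>-close to one of the integers, and as \<open>\<delta> < 1\<close> the
  components belonging to other integers are small.

  The local hypothesis enters through Garland's method. The quadratic form of \<open>lap\<close>, minus that of the identity,
  is the sum over faces \<open>\<eta>\<close> of one dimension less of the quadratic forms of the walks on the links of \<open>\<eta>\<close>
  (lemma \<open>lap_localization\<close>), and the form of \<open>up \<circ> dn\<close> is the corresponding sum of the projections onto constants.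
  In each link, the walk differs from that projection by an operator with spectrum in \<open>[-l, l]\<close>; hence
  \<open>lap - id - up \<circ> dn\<close> has norm at most \<open>(k + 1) l\<close> (lemma \<open>discrepancy_norm\<close>). To extract this from bounds on the
  second largest and the smallest eigenvalue, the extreme values of the Rayleigh quotient are shown to be
  eigenvalues, by compactness of the unit sphere (lemma \<open>rayleigh_minimizer\<close>).

  The near-integer property is proved by induction on \<open>k\<close>. On the last summand \<open>dn\<close> vanishes, so \<open>lap\<close> is close to
  the identity. An element \<open>\<phi>\<close> of another summand is \<open>up \<psi>\<close> with \<open>\<psi>\<close> one dimension lower, and
  \<open>up (dn \<phi>) = up (lap \<psi>)\<close>. The cochain \<open>\<psi>\<close> lies in the filtration step of index \<open>j\<close> but need not lie in the
  summand; the orthogonality of \<open>\<phi>\<close> to the earlier filtration step shows that the part of \<open>\<psi>\<close> outside the summand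
  is of the order of the error, so the induction hypothesis gives \<open>lap \<psi> \<approx> (k - j) \<psi>\<close>
  (lemma \<open>up_dn_near_integer\<close>). Adding the identity gives \<open>k + 1 - j\<close>.
\<close>

section \<open>Weighted inner products on functions on a finite set\<close>

definition wip :: "'b set \<Rightarrow> ('b \<Rightarrow> real) \<Rightarrow> ('b \<Rightarrow> real) \<Rightarrow> ('b \<Rightarrow> real) \<Rightarrow> real" where
  "wip A w f g = (\<Sum>x\<in>A. w x * f x * g x)"

definition wnorm :: "'b set \<Rightarrow> ('b \<Rightarrow> real) \<Rightarrow> ('b \<Rightarrow> real) \<Rightarrow> real" where
  "wnorm A w f = sqrt (wip A w f f)"

lemma sum_fun_apply: "(\<Sum>i\<in>I. f i) x = (\<Sum>i\<in>I. f i x)" for f :: "'i \<Rightarrow> 'b \<Rightarrow> real"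
  by (induction I rule: infinite_finite_induct) auto

lemma fscale_apply [simp]: "fscale c f x = c * f x"
  by (simp add: fscale_def)

lemma linear_operatorI:
  assumes "\<And>f g. T (f + g) = T f + T g" "\<And>c f. T (fscale c f) = fscale c (T f)"
  shows "module_hom fscale fscale T"
  by (intro module_hom.intro module_hom_axioms.intro fs.module_axioms assms)

lemma subspace_fun_on: "fs.subspace (fun_on A)"
  by (auto simp: fs.subspace_def fun_on_def)

lemma wip_commute: "wip A w f g = wip A w g f"
  by (simp add: wip_def mult.left_commute mult.commute)

lemma wip_add_left: "wip A w (f + g) h = wip A w f h + wip A w g h"
  and wip_diff_left: "wip A w (f - g) h = wip A w f h - wip A w g h"
  and wip_scale_left: "wip A w (fscale c f) h = c * wip A w f h"
  and wip_zero_left [simp]: "wip A w 0 h = 0"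
  by (simp_all add: wip_def algebra_simps sum.distrib sum_subtractf sum_distrib_left)

lemma wip_add_right: "wip A w h (f + g) = wip A w h f + wip A w h g"
  and wip_diff_right: "wip A w h (f - g) = wip A w h f - wip A w h g"
  and wip_scale_right: "wip A w h (fscale c f) = c * wip A w h f"
  and wip_zero_right [simp]: "wip A w h 0 = 0"
  by (simp_all add: wip_def algebra_simps sum.distrib sum_subtractf sum_distrib_left)

lemma wip_sum_left: "wip A w (\<Sum>i\<in>I. f i) h = (\<Sum>i\<in>I. wip A w (f i) h)"
  by (induction I rule: infinite_finite_induct) (simp_all only: sum.infinite sum.empty sum.insert wip_zero_left wip_add_left not_False_eq_True)

lemma wip_sum_right: "wip A w h (\<Sum>i\<in>I. f i) = (\<Sum>i\<in>I. wip A w h (f i))"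
  by (induction I rule: infinite_finite_induct) (simp_all only: sum.infinite sum.empty sum.insert wip_zero_right wip_add_right not_False_eq_True)

lemmas wip_linear = wip_add_left wip_diff_left wip_scale_left
  wip_add_right wip_diff_right wip_scale_right

lemma subspace_wip_orthogonal:
  "fs.subspace {f \<in> fun_on A. \<forall>g\<in>W. wip A w f g = 0}"
  by (auto simp: fs.subspace_def fun_on_def wip_linear)

locale weighted_space =
  fixes A :: "'b set" and w :: "'b \<Rightarrow> real"
  assumes fin: "finite A" and pos: "\<And>x. x \<in> A \<Longrightarrow> 0 < w x"
begin

lemma wip_self_nonneg: "0 \<le> wip A w f f"
  unfolding wip_def by (intro sum_nonneg) (auto simp: mult.assoc less_imp_le[OF pos])

lemma wnorm_nonneg [simp]: "0 \<le> wnorm A w f"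
  by (simp add: wnorm_def wip_self_nonneg)

lemma wnorm_square: "(wnorm A w f)\<^sup>2 = wip A w f f"
  by (simp add: wnorm_def wip_self_nonneg)

lemma wnorm_eq_L2_set: "wnorm A w f = L2_set (\<lambda>x. sqrt (w x) * f x) A"
  unfolding wnorm_def L2_set_def wip_def
  by (intro arg_cong[where f = sqrt] sum.cong)
     (auto simp: power_mult_distrib less_imp_le[OF pos] power2_eq_square mult.assoc)

lemma wip_self_eq_0: assumes "f \<in> fun_on A" "wip A w f f = 0" shows "f = 0"
proof
  fix x
  have "\<forall>x\<in>A. w x * f x * f x = 0"
    using assms(2) fin unfolding wip_def
    by (subst sum_nonneg_eq_0_iff[symmetric]) (auto simp: mult.assoc less_imp_le[OF pos])
  then show "f x = 0 x" using assms(1) pos by (cases "x \<in> A") (force simp: fun_on_def)+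
qed

lemma wip_self_pos: assumes "f \<in> fun_on A" "f \<noteq> 0" shows "0 < wip A w f f"
  using wip_self_eq_0[OF assms(1)] assms(2) wip_self_nonneg[of f] by fastforce

lemma cauchy_schwarz: "\<bar>wip A w f g\<bar> \<le> wnorm A w f * wnorm A w g"
proof -
  have "wip A w f g = (\<Sum>x\<in>A. (sqrt (w x) * f x) * (sqrt (w x) * g x))"
    unfolding wip_def by (intro sum.cong) (auto simp: less_imp_le[OF pos])
  also have "\<bar>\<dots>\<bar> \<le> (\<Sum>x\<in>A. \<bar>sqrt (w x) * f x\<bar> * \<bar>sqrt (w x) * g x\<bar>)"
    unfolding abs_mult[symmetric] by (rule sum_abs)
  also have "\<dots> \<le> wnorm A w f * wnorm A w g"
    unfolding wnorm_eq_L2_set by (rule L2_set_mult_ineq)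
  finally show ?thesis .
qed

lemma wnorm_triangle: "wnorm A w (f + g) \<le> wnorm A w f + wnorm A w g"
  unfolding wnorm_eq_L2_set using L2_set_triangle_ineq[of "\<lambda>x. sqrt (w x) * f x" "\<lambda>x. sqrt (w x) * g x" A]
  by (simp add: algebra_simps)

lemma wnorm_scale: "wnorm A w (fscale c f) = \<bar>c\<bar> * wnorm A w f"
  by (simp add: wnorm_def wip_linear real_sqrt_mult flip: mult.assoc)

lemma wnorm_triangle_diff: "wnorm A w (f - g) \<le> wnorm A w f + wnorm A w g"
proof -
  have "f - g = f + fscale (-1) g" by auto
  then show ?thesis using wnorm_triangle[of f "fscale (-1) g"] wnorm_scale[of "-1" g] by simp
qed

lemma wnorm_zero [simp]: "wnorm A w 0 = 0"
  by (simp add: wnorm_def)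

lemma wnorm_sum: "wnorm A w (\<Sum>i\<in>I. f i) \<le> (\<Sum>i\<in>I. wnorm A w (f i))"
proof (induction I rule: infinite_finite_induct)
  case (insert i I)
  then show ?case using wnorm_triangle[of "f i" "\<Sum>i\<in>I. f i"] by (simp only: sum.insert not_False_eq_True)
qed (simp_all only: sum.infinite sum.empty wnorm_zero order_refl not_False_eq_True)

lemma wnorm_leI: "wip A w f f \<le> c\<^sup>2 \<Longrightarrow> 0 \<le> c \<Longrightarrow> wnorm A w f \<le> c"
  unfolding wnorm_def by (rule real_le_lsqrt) (auto simp: wip_self_nonneg)

lemma fun_on_subset_span: "fun_on A \<subseteq> fs.span ((\<lambda>x. indicator {x}) ` A)"
proof
  fix f assume f: "f \<in> fun_on A"
  have "f = (\<Sum>x\<in>A. fscale (f x) (indicator {x}))"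
  proof
    fix y
    show "f y = (\<Sum>x\<in>A. fscale (f x) (indicator {x})) y"
      using f fin by (cases "y \<in> A") (auto simp: sum_fun_apply indicator_def fun_on_def if_distrib cong: if_cong)
  qed
  also have "\<dots> \<in> fs.span ((\<lambda>x. indicator {x}) ` A)"
    by (intro fs.span_sum fs.span_scale fs.span_base imageI)
  finally show "f \<in> fs.span ((\<lambda>x. indicator {x}) ` A)" .
qed

text \<open>Functions on a finite set are spanned by the indicators of its points. The finiteness matters because both
\<open>card\<close> and \<open>fs.dim\<close> default to 0 when there is no finite basis.\<close>

lemma independent_finite:
  assumes "B \<subseteq> fun_on A" "fs.independent B" shows "finite B"
  using fs.independent_span_bound[OF _ assms(2)] assms(1) fun_on_subset_span fin by blast

lemma independent_orthogonal:
  assumes "B \<subseteq> fun_on A" "0 \<notin> B" "\<And>f g. f \<in> B \<Longrightarrow> g \<in> B \<Longrightarrow> f \<noteq> g \<Longrightarrow> wip A w f g = 0"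
  shows "fs.independent B"
proof
  assume "fs.dependent B"
  then obtain S u v where S: "finite S" "S \<subseteq> B" "(\<Sum>f\<in>S. fscale (u f) f) = 0" "v \<in> S" "u v \<noteq> 0"
    unfolding fs.dependent_explicit by blast
  have "0 = wip A w (\<Sum>f\<in>S. fscale (u f) f) v" using S by simp
  also have "\<dots> = (\<Sum>f\<in>S. if f = v then u v * wip A w v v else 0)"
    unfolding wip_sum_left using S assms(3) by (intro sum.cong) (auto simp: wip_linear)
  also have "\<dots> = u v * wip A w v v" using S by simp
  finally have "wip A w v v = 0" using S by simp
  moreover have "v \<in> fun_on A" "v \<noteq> 0" using S assms(1,2) by auto
  ultimately show False using wip_self_pos[of v] by simp
qed

lemma card_le_dim:
  assumes "W \<subseteq> fun_on A" "B \<subseteq> W" "fs.independent B"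
  shows "card B \<le> fs.dim W"
proof -
  obtain C where C: "B \<subseteq> C" "C \<subseteq> W" "fs.independent C" "W \<subseteq> fs.span C"
    using fs.maximal_independent_subset_extend[OF assms(2,3)] by blast
  then have "card C = fs.dim W" by (intro fs.basis_card_eq_dim)
  moreover have "finite C" using independent_finite C assms by blast
  ultimately show ?thesis using card_mono C(1) by metis
qed

lemma orthogonal_to_span:
  assumes "\<And>h. h \<in> B \<Longrightarrow> wip A w u h = 0" "v \<in> fs.span B"
  shows "wip A w u v = 0"
proof -
  have "fs.span B \<subseteq> {v. wip A w u v = 0}"
    using assms(1) by (intro fs.span_minimal) (auto simp: fs.subspace_def wip_linear)
  then show ?thesis using assms(2) by blast
qed

text \<open>Gram--Schmidt: for a new generator \<open>b\<close>, only the part \<open>q\<close> of \<open>b\<close> orthogonal to the earlier generators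
contributes, and the projection onto the line of \<open>q\<close> is added.\<close>

lemma projection_onto_span:
  assumes "finite B" "B \<subseteq> fun_on A"
  shows "\<exists>g\<in>fs.span B. \<forall>h\<in>B. wip A w (f - g) h = 0"
  using assms
proof (induction B arbitrary: f)
  case (insert b B)
  have spB: "fs.span B \<subseteq> fun_on A"
    using insert by (intro fs.span_minimal subspace_fun_on) auto
  obtain p where p: "p \<in> fs.span B" "\<forall>h\<in>B. wip A w (b - p) h = 0" using insert.IH[of b] insert.prems by blast
  obtain g where g: "g \<in> fs.span B" "\<forall>h\<in>B. wip A w (f - g) h = 0" using insert.IH[of f] insert.prems by blast
  define q where "q = b - p"
  have sub: "fs.span B \<subseteq> fs.span (insert b B)" by (rule fs.span_mono) auto
  have q: "q \<in> fs.span (insert b B)"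
    unfolding q_def using p sub by (intro fs.span_diff) (auto intro: fs.span_base)
  have qon: "q \<in> fun_on A"
    using p spB insert.prems unfolding q_def by (intro fs.subspace_diff[OF subspace_fun_on]) auto
  define t where "t = wip A w (f - g) q / wip A w q q"
  show ?case
  proof (intro bexI ballI)
    show "g + fscale t q \<in> fs.span (insert b B)"
      using q g sub by (intro fs.span_add fs.span_scale) auto
    have Bh: "wip A w (f - (g + fscale t q)) h = 0" if "h \<in> B" for h
      using that g p by (simp add: wip_linear q_def)
    have qq: "wip A w (f - (g + fscale t q)) q = 0"
    \<comment> \<open>If \<open>q = 0\<close>, the generator lies in the earlier span and \<open>t\<close> is a harmless division by zero.\<close>
  proof (cases "q = 0")
      case False
      then show ?thesis using wip_self_pos[OF qon] by (simp add: wip_linear t_def)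
    qed auto
    fix h assume "h \<in> insert b B"
    moreover have "b = q + p" by (simp add: q_def)
    ultimately show "wip A w (f - (g + fscale t q)) h = 0"
      using Bh qq orthogonal_to_span[of B "f - (g + fscale t q)" p] p(1) by (auto simp: wip_add_right)
  qed
qed auto

lemma projection_exists:
  assumes "fs.subspace W" "W \<subseteq> fun_on A"
  obtains g where "g \<in> W" "\<And>h. h \<in> W \<Longrightarrow> wip A w (f - g) h = 0"
proof -
  obtain B where B: "B \<subseteq> W" "fs.independent B" "W \<subseteq> fs.span B" using fs.basis_exists by metis
  have W: "W = fs.span B" using B fs.span_minimal[OF B(1) assms(1)] by auto
  have "B \<subseteq> fun_on A" "finite B" using B assms independent_finite by auto
  then obtain g where g: "g \<in> fs.span B" "\<forall>h\<in>B. wip A w (f - g) h = 0" using projection_onto_span by blast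
  have "wip A w (f - g) h = 0" if "h \<in> fs.span B" for h
    using orthogonal_to_span[OF _ that] g by blast
  with g W that show ?thesis by blast
qed

text \<open>The norm of a self-adjoint operator is the supremum of its quadratic form. By polarization and the
parallelogram law, \<open>4\<langle>Tu, v\<rangle> \<le> 2c(\<parallel>u\<parallel>\<^sup>2 + \<parallel>v\<parallel>\<^sup>2)\<close>; this is used for \<open>u = f\<close> and for the multiple \<open>v\<close> of
\<open>Tf\<close> that has the same norm as \<open>f\<close>.\<close>

lemma selfadjoint_norm_le:
  assumes T: "module_hom fscale fscale T"
    and sa: "\<And>f g. wip A w (T f) g = wip A w f (T g)"
    and bound: "\<And>f. \<bar>wip A w (T f) f\<bar> \<le> c * wip A w f f"
  shows "wnorm A w (T f) \<le> c * wnorm A w f"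
proof -
  interpret T: module_hom fscale fscale T by (rule T)
  have polar: "4 * wip A w (T u) v \<le> c * (2 * wip A w u u + 2 * wip A w v v)" for u v
  proof -
    have "4 * wip A w (T u) v = wip A w (T (u + v)) (u + v) - wip A w (T (u - v)) (u - v)"
      using sa[of v u] by (simp add: T.add T.diff wip_linear wip_commute[of A w v])
    also have "\<dots> \<le> c * wip A w (u + v) (u + v) + c * wip A w (u - v) (u - v)"
      using bound[of "u + v"] bound[of "u - v"] by linarith
    finally show ?thesis by (simp add: wip_linear wip_commute algebra_simps)
  qed
  let ?a = "wnorm A w f" and ?b = "wnorm A w (T f)"
  have main: "4 * (t * ?b\<^sup>2) \<le> c * (2 * ?a\<^sup>2 + 2 * (t\<^sup>2 * ?b\<^sup>2))" for t
    using polar[of f "fscale t (T f)"] by (simp add: wip_linear wnorm_square) (simp add: power2_eq_square mult.assoc)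
  show ?thesis
  proof (cases "?b = 0")
    case True
    have "0 \<le> c * ?a\<^sup>2" using bound[of f] by (simp add: wnorm_square)
    then have "?a = 0 \<or> 0 \<le> c" using zero_le_mult_iff[of c "?a\<^sup>2"] by auto
    then show ?thesis using True by auto
  next
    case False
    then have b: "?b > 0" using wnorm_nonneg[of "T f"] by linarith
    show ?thesis
    proof (cases "?a = 0")
      case True
      have "?b\<^sup>2 = wip A w f (T (T f))" by (simp add: wnorm_square flip: sa)
      also have "\<dots> \<le> 0" using cauchy_schwarz[of f "T (T f)"] True by simp
      finally show ?thesis using b by simp
    next
      case a: False
      then have a: "?a > 0" using wnorm_nonneg[of f] by linarith
      have "4 * (?a * ?b) \<le> 4 * (c * ?a\<^sup>2)"
        using main[of "?a / ?b"] b by (simp add: power2_eq_square field_simps)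
      then show ?thesis using a by (simp add: power2_eq_square)
    qed
  qed
qed

lemma wip_orthogonal_sum:
  assumes "finite I" "\<And>i j. i \<in> I \<Longrightarrow> j \<in> I \<Longrightarrow> i \<noteq> j \<Longrightarrow> wip A w (\<psi> i) (\<psi> j) = 0"
  shows "wip A w (\<Sum>i\<in>I. fscale (a i) (\<psi> i)) (\<Sum>i\<in>I. fscale (b i) (\<psi> i))
    = (\<Sum>i\<in>I. a i * b i * wip A w (\<psi> i) (\<psi> i))"
proof -
  have "wip A w (\<Sum>i\<in>I. fscale (a i) (\<psi> i)) (\<Sum>i\<in>I. fscale (b i) (\<psi> i))
    = (\<Sum>i\<in>I. \<Sum>j\<in>I. if j = i then a i * b i * wip A w (\<psi> i) (\<psi> i) else 0)"
    unfolding wip_sum_left wip_sum_right using assms(2)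
    by (intro sum.cong refl) (auto simp: wip_linear)
  then show ?thesis using assms(1) by simp
qed

text \<open>Errors of orthogonal almost eigenvectors may add up in the same direction, which costs the factor
\<open>sqrt (card I)\<close>: the sum of the norms is compared with the norm of the sum by Cauchy--Schwarz.\<close>

lemma almost_eigenvector_sum:
  assumes T: "module_hom fscale fscale T" and I: "finite I" and e: "0 \<le> e"
    and orth: "\<And>i j. i \<in> I \<Longrightarrow> j \<in> I \<Longrightarrow> i \<noteq> j \<Longrightarrow> wip A w (\<psi> i) (\<psi> j) = 0"
    and approx: "\<And>i. i \<in> I \<Longrightarrow> wnorm A w (T (\<psi> i) - fscale (c i) (\<psi> i)) \<le> e * wnorm A w (\<psi> i)"
  shows "wnorm A w (T (\<Sum>i\<in>I. \<psi> i) - (\<Sum>i\<in>I. fscale (c i) (\<psi> i)))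
    \<le> sqrt (card I) * e * wnorm A w (\<Sum>i\<in>I. \<psi> i)"
proof -
  interpret T: module_hom fscale fscale T by (rule T)
  have "T (\<Sum>i\<in>I. \<psi> i) - (\<Sum>i\<in>I. fscale (c i) (\<psi> i)) = (\<Sum>i\<in>I. T (\<psi> i) - fscale (c i) (\<psi> i))"
    by (simp add: T.sum sum_subtractf)
  then have "wnorm A w (T (\<Sum>i\<in>I. \<psi> i) - (\<Sum>i\<in>I. fscale (c i) (\<psi> i)))
      \<le> (\<Sum>i\<in>I. wnorm A w (T (\<psi> i) - fscale (c i) (\<psi> i)))"
    using wnorm_sum by metis
  also have "\<dots> \<le> e * (\<Sum>i\<in>I. wnorm A w (\<psi> i))"
    unfolding sum_distrib_left by (intro sum_mono approx)
  also have "(\<Sum>i\<in>I. wnorm A w (\<psi> i)) \<le> sqrt ((\<Sum>i\<in>I. (wnorm A w (\<psi> i))\<^sup>2) * card I)"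
    by (intro real_le_rsqrt sum_squared_le_sum_of_squares)
  also have "(\<Sum>i\<in>I. (wnorm A w (\<psi> i))\<^sup>2) = wip A w (\<Sum>i\<in>I. \<psi> i) (\<Sum>i\<in>I. \<psi> i)"
    using wip_orthogonal_sum[OF I orth, where a = "\<lambda>_. 1" and b = "\<lambda>_. 1"] by (simp add: wnorm_square fscale_def)
  finally show ?thesis using e
    by (simp only: real_sqrt_mult mult_left_mono mult_right_mono wnorm_def[of _ _ "\<Sum>i\<in>I. \<psi> i"] mult.assoc mult.left_commute mult.commute)
qed

end

section \<open>Symmetric kernel operators and the variational principle\<close>

text \<open>Dividing the kernel \<open>b\<close> by the weight at the output makes the operator self-adjoint for the weighted inner
product when \<open>b\<close> is symmetric.\<close>

definition kernel_op :: "'b set \<Rightarrow> ('b \<Rightarrow> real) \<Rightarrow> ('b \<Rightarrow> 'b \<Rightarrow> real) \<Rightarrow> ('b \<Rightarrow> real) \<Rightarrow> 'b \<Rightarrow> real" where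
  "kernel_op A w b f = (\<lambda>x. if x \<in> A then (\<Sum>y\<in>A. b x y / w x * f y) else 0)"

lemma kernel_op_in: "kernel_op A w b f \<in> fun_on A"
  by (simp add: kernel_op_def fun_on_def)

lemma kernel_op_linear: "module_hom fscale fscale (kernel_op A w b)"
  by (intro linear_operatorI)
     (auto simp: kernel_op_def fun_eq_iff sum.distrib distrib_left add_divide_distrib sum_distrib_left mult_ac)

text \<open>Tychonoff's theorem for the product topology on the function type. The unit sphere of the functions on a
finite set, extended by zero, lies in such a box.\<close>

lemma compact_box_functions:
  fixes B :: "'b \<Rightarrow> real"
  shows "compact {f :: 'b \<Rightarrow> real. \<forall>x. \<bar>f x\<bar> \<le> B x}"
proof -
  have "compactin (product_topology (\<lambda>_. euclideanreal) UNIV) (PiE UNIV (\<lambda>x. {- B x..B x}))"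
    by (simp add: compactin_PiE)
  moreover have "PiE UNIV (\<lambda>x. {- B x..B x}) = {f :: 'b \<Rightarrow> real. \<forall>x. \<bar>f x\<bar> \<le> B x}"
    by (auto simp: PiE_UNIV_domain abs_le_iff minus_le_iff)
  ultimately show ?thesis by (simp add: euclidean_product_topology)
qed

context weighted_space
begin

lemma wip_kernel_op: "wip A w (kernel_op A w b f) g = (\<Sum>x\<in>A. \<Sum>y\<in>A. b x y * f y * g x)"
proof -
  have "w x * kernel_op A w b f x * g x = (\<Sum>y\<in>A. b x y * f y * g x)" if "x \<in> A" for x
    using that pos[OF that] by (simp add: kernel_op_def sum_distrib_left sum_distrib_right)
  then show ?thesis unfolding wip_def by simp
qed

lemma kernel_op_selfadjoint:
  assumes "\<And>x y. b x y = b y x"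
  shows "wip A w (kernel_op A w b f) g = wip A w f (kernel_op A w b g)"
proof -
  have "wip A w f (kernel_op A w b g) = (\<Sum>x\<in>A. \<Sum>y\<in>A. b x y * g y * f x)"
    by (subst wip_commute) (rule wip_kernel_op)
  also have "\<dots> = (\<Sum>y\<in>A. \<Sum>x\<in>A. b x y * g y * f x)" by (rule sum.swap)
  also have "\<dots> = wip A w (kernel_op A w b f) g"
    unfolding wip_kernel_op using assms by (intro sum.cong refl) (auto simp: mult_ac)
  finally show ?thesis by simp
qed

text \<open>The Rayleigh quotient attains its minimum over an invariant hyperplane \<open>h\<^sup>\<bottom>\<close>, since the unit sphere is
compact. At a minimizer \<open>f\<close> with value \<open>c\<close> the form \<open>\<langle>Tg, g\<rangle> - c\<langle>g, g\<rangle>\<close> is nonnegative and vanishes, so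
its first variation \<open>\<langle>Tf - cf, g\<rangle>\<close> vanishes for all \<open>g\<close> in the hyperplane; invariance allows
\<open>g = Tf - cf\<close>, and \<open>f\<close> is an eigenvector. The choice \<open>h = 0\<close> gives the whole space.\<close>

lemma rayleigh_minimizer:
  assumes b: "\<And>x y. b x y = b y x"
    and T: "T = kernel_op A w b"
    and inv: "\<And>f. f \<in> fun_on A \<Longrightarrow> wip A w f h = 0 \<Longrightarrow> wip A w (T f) h = 0"
    and ex: "f0 \<in> fun_on A" "wip A w f0 h = 0" "f0 \<noteq> 0"
  obtains f c where "f \<in> fun_on A" "wip A w f h = 0" "f \<noteq> 0" "T f = fscale c f"
    "\<And>g. g \<in> fun_on A \<Longrightarrow> wip A w g h = 0 \<Longrightarrow> c * wip A w g g \<le> wip A w (T g) g"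
proof -
  interpret T: module_hom fscale fscale T unfolding T by (rule kernel_op_linear)
  define W where "W = {f \<in> fun_on A. wip A w f h = 0}"
  define K where "K = {f \<in> W. wip A w f f = 1}"
  define B where "B x = (if x \<in> A then 1 / sqrt (w x) else 0)" for x
  have W: "fs.subspace W"
    using subspace_wip_orthogonal[of A "{h}" w] by (simp add: W_def)
  have cont: "continuous_on S (\<lambda>f :: 'b \<Rightarrow> real. f x)" for S x
    by (rule continuous_on_subset[OF continuous_on_product_coordinates]) simp
  have KB: "K \<subseteq> {f. \<forall>x. \<bar>f x\<bar> \<le> B x}"
  proof clarify
    fix f x assume f: "f \<in> K"
    show "\<bar>f x\<bar> \<le> B x"
    proof (cases "x \<in> A")
      case True
      have "w x * f x * f x \<le> wip A w f f"
        unfolding wip_def using True fin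
        by (intro member_le_sum) (auto simp: mult.assoc less_imp_le[OF pos])
      then have "(f x)\<^sup>2 \<le> 1 / w x"
        using f pos[OF True] by (simp add: K_def power2_eq_square field_simps)
      then show ?thesis using True real_le_rsqrt[of "\<bar>f x\<bar>" "1 / w x"]
        by (simp add: B_def real_sqrt_divide)
    next
      case False
      then show ?thesis using f by (simp add: K_def W_def fun_on_def B_def)
    qed
  qed
  have "K = {f. (\<forall>x\<in>-A. f x = 0) \<and> wip A w f h = 0 \<and> wip A w f f = 1}"
    by (auto simp: K_def W_def fun_on_def)
  also have "closed \<dots>"
    unfolding wip_def Ball_def
    by (intro closed_Collect_conj closed_Collect_all closed_Collect_imp open_Collect_const
        closed_Collect_eq continuous_intros cont)
  finally have "closed K" .
  then have "compact K"
    using compact_Int_closed[OF compact_box_functions[of B]] KB by (metis inf.absorb_iff2)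
  moreover have "fscale (1 / sqrt (wip A w f0 f0)) f0 \<in> K"
    using ex wip_self_pos[of f0] W by (auto simp: K_def W_def fs.subspace_def wip_linear)
  then have "K \<noteq> {}" by blast
  moreover have "continuous_on K (\<lambda>f. wip A w (T f) f)"
    unfolding T wip_kernel_op by (intro continuous_intros cont)
  ultimately obtain f where f: "f \<in> K" "\<And>g. g \<in> K \<Longrightarrow> wip A w (T f) f \<le> wip A w (T g) g"
    using continuous_attains_inf[of K] by blast
  define c where "c = wip A w (T f) f"
  have ff: "wip A w f f = 1" "f \<in> W" "f \<in> fun_on A" "wip A w f h = 0"
    using f by (auto simp: K_def W_def)
  have c: "c * wip A w g g \<le> wip A w (T g) g" if g: "g \<in> W" for g
  proof (cases "g = 0")
    case False
    then have p: "wip A w g g > 0" using wip_self_pos g by (auto simp: W_def)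
    let ?s = "1 / sqrt (wip A w g g)"
    have "fscale ?s g \<in> K"
      using g p W by (auto simp: K_def W_def fs.subspace_def wip_linear)
    from f(2)[OF this] have "c \<le> ?s * (?s * wip A w (T g) g)"
      by (simp add: c_def T.scale wip_linear)
    then show ?thesis using p by (simp add: field_simps)
  qed (simp add: T.zero)
  have crit: "wip A w (T f - fscale c f) g = 0" if g: "g \<in> W" for g
  proof -
    define \<alpha> where "\<alpha> = wip A w (T f - fscale c f) g"
    define \<beta> where "\<beta> = wip A w (T g) g - c * wip A w g g"
    have main: "0 \<le> 2 * t * \<alpha> + t\<^sup>2 * \<beta>" for t
    proof -
      have "f + fscale t g \<in> W" using W g ff by (simp add: fs.subspace_def)
      from c[OF this] have "c * wip A w (f + fscale t g) (f + fscale t g)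
        \<le> wip A w (T (f + fscale t g)) (f + fscale t g)" .
      moreover have "wip A w (T g) f = wip A w (T f) g"
        unfolding T by (subst kernel_op_selfadjoint[OF b]) (rule wip_commute)
      moreover have "wip A w g f = wip A w f g" by (rule wip_commute)
      ultimately show ?thesis
        using ff by (simp add: T.add T.scale wip_linear \<alpha>_def \<beta>_def c_def[symmetric]
            power2_eq_square algebra_simps)
    qed
    show ?thesis
    proof (rule ccontr)
      assume "\<not> ?thesis"
      then have "\<alpha> \<noteq> 0" by (simp add: \<alpha>_def)
      have \<beta>: "\<beta> \<ge> 0" using c[OF g] by (simp add: \<beta>_def)
      \<comment> \<open>The quadratic \<open>2t\<alpha> + t\<^sup>2\<beta>\<close> is negative at \<open>t = -\<alpha>/(\<beta> + 1)\<close>; the shift by 1 avoids division by zero.\<close>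
      define q where "q = \<alpha> / (\<beta> + 1)"
      have q: "\<alpha> = q * (\<beta> + 1)" "q \<noteq> 0" using \<beta> \<open>\<alpha> \<noteq> 0\<close> by (auto simp: q_def)
      have "0 \<le> 2 * (- q) * \<alpha> + (- q)\<^sup>2 * \<beta>" by (rule main)
      also have "\<dots> = - (q\<^sup>2 * (\<beta> + 2))"
        unfolding q(1) by (simp add: power2_eq_square algebra_simps)
      also have "\<dots> < 0" using \<beta> q(2) by simp
      finally show False by simp
    qed
  qed
  have in_W: "T f - fscale c f \<in> W"
  proof (rule fs.subspace_diff[OF W])
    show "T f \<in> W" using inv[OF ff(3,4)] kernel_op_in by (auto simp: W_def T)
    show "fscale c f \<in> W" using W ff by (simp add: fs.subspace_def)
  qed
  then have "T f - fscale c f = 0"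
    using crit[OF in_W] wip_self_eq_0 in_W unfolding W_def by blast
  then have "T f = fscale c f" by simp
  moreover have "f \<noteq> 0" using ff by auto
  ultimately show ?thesis using that ff c by (simp add: W_def)
qed

end

section \<open>Eigenvalues counted with multiplicity\<close>

text \<open>If two members of a descending list are at least \<open>b\<close>, then so is the entry at index 1: otherwise only the
head could be.\<close>

lemma second_of_descending_ge:
  fixes M :: "real multiset"
  assumes "{#a, b#} \<subseteq># M" "b \<le> a"
  shows "b \<le> rev (sorted_list_of_multiset M) ! 1"
proof (rule ccontr)
  define L where "L = rev (sorted_list_of_multiset M)"
  have M: "mset L = M" by (simp add: L_def)
  have desc: "sorted_wrt (\<ge>) L"
    unfolding L_def sorted_wrt_rev by simp
  have "size (filter_mset (\<lambda>x. b \<le> x) {#a, b#}) \<le> size (filter_mset (\<lambda>x. b \<le> x) M)"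
    using assms(1) by (intro size_mset_mono multiset_filter_mono)
  then have two: "2 \<le> length (filter (\<lambda>x. b \<le> x) L)"
    using assms(2) unfolding M[symmetric] by (simp flip: mset_filter)
  assume "\<not> ?thesis"
  then have lt: "L ! 1 < b" by (simp add: L_def)
  obtain x L' where L: "L = x # L'" using two by (cases L) auto
  then obtain y L'' where L': "L' = y # L''" using two by (cases L') (auto split: if_splits)
  have "\<forall>z\<in>set L'. z < b" using desc lt unfolding L L' by auto
  then have "filter (\<lambda>x. b \<le> x) L' = []" by (auto simp: filter_empty_conv)
  then show False using two L by (auto split: if_splits)
qed

context weighted_space
begin

lemma eigenvectors_orthogonal:
  assumes sa: "\<And>f g. wip A w (T f) g = wip A w f (T g)"
    and "T f = fscale c f" "T g = fscale d g" "c \<noteq> d"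
  shows "wip A w f g = 0"
  using sa[of f g] assms(2-4) by (simp add: wip_linear)

text \<open>Eigenvectors for distinct eigenvalues are orthogonal, hence independent. Without finiteness the minimum
in \<open>smallest_eigenvalue\<close> and the sum in \<open>Spec_mset\<close> would be meaningless default values.\<close>

lemma finite_Spec:
  assumes sa: "\<And>f g. wip A w (T f) g = wip A w f (T g)"
  shows "finite (Spec (fun_on A) T)"
proof -
  define S where "S = Spec (fun_on A) T"
  define e where "e c = (SOME f. f \<in> fun_on A \<and> f \<noteq> 0 \<and> T f = fscale c f)" for c
  have e: "e c \<in> fun_on A" "e c \<noteq> 0" "T (e c) = fscale c (e c)" if "c \<in> S" for c
  proof -
    have "\<exists>f. f \<in> fun_on A \<and> f \<noteq> 0 \<and> T f = fscale c f" using that by (auto simp: S_def Spec_def)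
    from someI_ex[OF this] show "e c \<in> fun_on A" "e c \<noteq> 0" "T (e c) = fscale c (e c)"
      by (auto simp: e_def)
  qed
  have orth: "wip A w (e c) (e d) = 0" if "c \<in> S" "d \<in> S" "c \<noteq> d" for c d
    using eigenvectors_orthogonal[OF sa] e that by blast
  have "inj_on e S"
  proof (rule inj_onI, rule ccontr)
    fix c d assume "c \<in> S" "d \<in> S" "e c = e d" "c \<noteq> d"
    then show False using orth[of c d] wip_self_pos[of "e c"] e by auto
  qed
  moreover have "finite (e ` S)"
    using e orth by (intro independent_finite independent_orthogonal) (auto, metis)
  ultimately show ?thesis unfolding S_def[symmetric] by (simp add: finite_image_iff)
qed

lemma count_Spec_mset:
  assumes sa: "\<And>f g. wip A w (T f) g = wip A w f (T g)"
    and B: "B \<subseteq> fun_on A" "0 \<notin> B" "\<And>f. f \<in> B \<Longrightarrow> T f = fscale c f"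
    and orth: "\<And>f g. f \<in> B \<Longrightarrow> g \<in> B \<Longrightarrow> f \<noteq> g \<Longrightarrow> wip A w f g = 0"
  shows "card B \<le> count (Spec_mset (fun_on A) T) c"
proof (cases "B = {}")
  case False
  then have c: "c \<in> Spec (fun_on A) T" using B by (fastforce simp: Spec_def)
  have "card B \<le> fs.dim (eigenspace (fun_on A) T c)"
    using B orth by (intro card_le_dim independent_orthogonal) (auto simp: eigenspace_def)
  also have "\<dots> = count (Spec_mset (fun_on A) T) c"
    using finite_Spec[OF sa] c by (simp add: Spec_mset_def count_sum)
  finally show ?thesis .
qed simp

text \<open>The condition that the eigenvectors are orthogonal matters when \<open>a = b\<close>: then they witness that the
multiplicity is at least two, and the second largest eigenvalue is still at least \<open>b\<close>.\<close>

lemma eigenvalue_le_second_largest: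
  assumes sa: "\<And>f g. wip A w (T f) g = wip A w f (T g)"
    and f: "f \<in> fun_on A" "f \<noteq> 0" "T f = fscale a f"
    and g: "g \<in> fun_on A" "g \<noteq> 0" "T g = fscale b g"
    and "wip A w f g = 0" "b \<le> a"
  shows "b \<le> second_largest_eigenvalue (fun_on A) T"
proof -
  have "f \<noteq> g" using wip_self_pos f(1,2) assms(8) by fastforce
  have "{#a, b#} \<subseteq># Spec_mset (fun_on A) T"
  proof (cases "a = b")
    case True
    then have "card {f, g} \<le> count (Spec_mset (fun_on A) T) a"
      using f g assms(8) by (intro count_Spec_mset[OF sa]) (auto simp: wip_commute)
    then show ?thesis using True \<open>f \<noteq> g\<close> by (auto simp: subseteq_mset_def)
  next
    case False
    have "card {f} \<le> count (Spec_mset (fun_on A) T) a" "card {g} \<le> count (Spec_mset (fun_on A) T) b"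
      using f g by (intro count_Spec_mset[OF sa]; auto)+
    then show ?thesis using False by (auto simp: subseteq_mset_def)
  qed
  then show ?thesis
    unfolding second_largest_eigenvalue_def using assms(9) by (rule second_of_descending_ge)
qed

lemma smallest_eigenvalue_le:
  assumes sa: "\<And>f g. wip A w (T f) g = wip A w f (T g)"
    and "f \<in> fun_on A" "f \<noteq> 0" "T f = fscale a f"
  shows "smallest_eigenvalue (fun_on A) T \<le> a"
  unfolding smallest_eigenvalue_def using assms finite_Spec[OF sa]
  by (intro Min_le) (auto simp: Spec_def)

end

section \<open>Random walks on weighted graphs\<close>

locale weighted_graph = weighted_space +
  fixes b :: "'a \<Rightarrow> 'a \<Rightarrow> real"
  assumes sym: "b x y = b y x" and edge_nonneg: "0 \<le> b x y"
    and degree: "x \<in> A \<Longrightarrow> w x = (\<Sum>y\<in>A. b x y)"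
begin

abbreviation walk where "walk \<equiv> kernel_op A w b"
abbreviation one where "one \<equiv> indicator A"

lemma one_in: "one \<in> fun_on A"
  by (simp add: fun_on_def)

lemma walk_one: "walk one = one"
  using pos by (auto simp: kernel_op_def fun_eq_iff degree[symmetric] sum_divide_distrib[symmetric] less_imp_neq[symmetric])

text \<open>\<open>2|f x f y| \<le> (f x)\<^sup>2 + (f y)\<^sup>2\<close>, summed against the edge weights. It shows that no eigenvalue exceeds
the eigenvalue 1 of the constants.\<close>

lemma walk_contraction: "\<bar>wip A w (walk f) f\<bar> \<le> wip A w f f"
proof -
  have deg: "(\<Sum>x\<in>A. \<Sum>y\<in>A. b x y * (f x)\<^sup>2) = wip A w f f"
    unfolding wip_def by (intro sum.cong refl) (simp add: degree sum_distrib_right power2_eq_square mult.assoc)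
  have deg': "(\<Sum>x\<in>A. \<Sum>y\<in>A. b x y * (f y)\<^sup>2) = wip A w f f"
    by (subst sum.swap) (simp add: sym deg)
  have "\<bar>wip A w (walk f) f\<bar> \<le> (\<Sum>x\<in>A. \<Sum>y\<in>A. \<bar>b x y * f y * f x\<bar>)"
    unfolding wip_kernel_op by (rule order_trans[OF sum_abs] sum_mono)+ simp
  also have "\<dots> \<le> (\<Sum>x\<in>A. \<Sum>y\<in>A. (b x y * (f x)\<^sup>2 + b x y * (f y)\<^sup>2) / 2)"
  proof (intro sum_mono)
    fix x y
    have "0 \<le> (\<bar>f x\<bar> - \<bar>f y\<bar>)\<^sup>2" by simp
    then have "\<bar>f y * f x\<bar> \<le> ((f x)\<^sup>2 + (f y)\<^sup>2) / 2"
      by (simp add: power2_eq_square algebra_simps abs_mult)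
    then show "\<bar>b x y * f y * f x\<bar> \<le> (b x y * (f x)\<^sup>2 + b x y * (f y)\<^sup>2) / 2"
      using mult_left_mono[OF _ edge_nonneg[of x y]] edge_nonneg[of x y]
      by (fastforce simp: abs_mult mult.assoc distrib_left)
  qed
  also have "\<dots> = wip A w f f"
    by (simp add: sum_divide_distrib[symmetric] sum.distrib deg deg')
  finally show ?thesis .
qed

text \<open>The minimum of the Rayleigh quotient is an eigenvalue, so it is bounded below by the smallest one. Its
maximum over the complement of the constants is an eigenvalue with an eigenvector orthogonal to the
constant one, so it is at most the second largest eigenvalue, whether or not it equals 1.\<close>

lemma walk_quadratic_form:
  assumes lo: "- l \<le> smallest_eigenvalue (fun_on A) walk"
    and hi: "second_largest_eigenvalue (fun_on A) walk \<le> l"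
    and f: "f \<in> fun_on A" "wip A w f one = 0"
  shows "\<bar>wip A w (walk f) f\<bar> \<le> l * wip A w f f"
proof (cases "f = 0")
  case False
  have sa: "wip A w (walk f) g = wip A w f (walk g)" for f g
    by (rule kernel_op_selfadjoint[OF sym])
  have lower: "- l * wip A w f f \<le> wip A w (walk f) f"
  proof -
    obtain g c where g: "g \<in> fun_on A" "g \<noteq> 0" "walk g = fscale c g"
      and c: "\<And>g. g \<in> fun_on A \<Longrightarrow> c * wip A w g g \<le> wip A w (walk g) g"
      by (rule rayleigh_minimizer[where b = b, OF sym refl, where h = 0 and ?f0.0 = f]) (use f False in auto)
    have "- l \<le> c" using smallest_eigenvalue_le[OF sa g] lo by simp
    then show ?thesis
      using c[OF f(1)] mult_right_mono[OF _ wip_self_nonneg[of f], of "- l" c] by linarith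
  qed
  have upper: "wip A w (walk f) f \<le> l * wip A w f f"
  proof -
    \<comment> \<open>The maximum for the walk is the minimum for its negative, which is again given by a symmetric kernel.\<close>
    define T where "T = kernel_op A w (\<lambda>x y. - b x y)"
    have T: "T g = - walk g" for g
      by (auto simp: T_def kernel_op_def fun_eq_iff sum_negf)
    have neg: "wip A w (- u) v = - wip A w u v" for u v
      by (simp add: wip_def sum_negf)
    have inv: "wip A w (T g) one = 0" if "wip A w g one = 0" for g
      using that by (simp add: T neg sa walk_one)
    obtain g c where g: "g \<in> fun_on A" "wip A w g one = 0" "g \<noteq> 0" "T g = fscale c g"
      and c: "\<And>g. g \<in> fun_on A \<Longrightarrow> wip A w g one = 0 \<Longrightarrow> c * wip A w g g \<le> wip A w (T g) g"
      by (rule rayleigh_minimizer[OF _ T_def, where h = one and ?f0.0 = f]) (use f False inv in \<open>auto simp: sym\<close>)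
    have Tg: "walk g = fscale (- c) g"
      using g(4) unfolding T by (auto simp: fun_eq_iff) (metis minus_equation_iff)
    have gp: "wip A w g g > 0" using wip_self_pos g by blast
    have "\<bar>c\<bar> * wip A w g g \<le> 1 * wip A w g g"
      using walk_contraction[of g] gp by (simp add: Tg wip_linear neg abs_mult)
    then have "- c \<le> 1" using gp by (simp add: mult_le_cancel_right)
    moreover have "one \<noteq> 0" using g(3,1) by (auto simp: fun_eq_iff fun_on_def indicator_def split: if_splits)
    moreover have "walk one = fscale 1 one" by (simp add: walk_one fscale_def)
    ultimately have "- c \<le> second_largest_eigenvalue (fun_on A) walk"
      using g Tg one_in by (intro eigenvalue_le_second_largest[OF sa, of one 1 g]) (auto simp: wip_commute)
    then have "- c \<le> l" using hi by simp
    then show ?thesis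
      using c[OF f] mult_right_mono[OF _ wip_self_nonneg[of f], of "- c" l] by (simp add: T neg)
  qed
  show ?thesis using lower upper by auto
qed simp

text \<open>Subtracting the projection onto the constants, whose quadratic form is the square of the total of \<open>w f\<close>
divided by the total weight, extends the bound from mean-zero functions to all functions.\<close>

lemma walk_minus_mean_form:
  assumes "- l \<le> smallest_eigenvalue (fun_on A) walk"
    and "second_largest_eigenvalue (fun_on A) walk \<le> l"
    and "0 \<le> l" and f: "f \<in> fun_on A"
  shows "\<bar>wip A w (walk f) f - (\<Sum>x\<in>A. w x * f x)\<^sup>2 / sum w A\<bar> \<le> l * wip A w f f"
proof (cases "A = {}")
  case False
  interpret T: module_hom fscale fscale walk by (rule kernel_op_linear)
  define a where "a = (\<Sum>x\<in>A. w x * f x) / sum w A"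
  define g where "g = f - fscale a one"
  have M: "sum w A > 0" using False fin pos by (intro sum_pos) auto
  have f1: "wip A w f one = a * sum w A" using M by (simp add: wip_def a_def)
  have oo: "wip A w one one = sum w A" by (simp add: wip_def)
  have g: "g \<in> fun_on A" using f one_in unfolding g_def
    by (intro fs.subspace_diff fs.subspace_scale subspace_fun_on)
  have g1: "wip A w g one = 0" by (simp add: g_def wip_linear f1 oo)
  have fg: "f = g + fscale a one" by (simp add: g_def)
  have 1: "wip A w (walk one) g = 0" by (simp add: walk_one wip_commute[of _ _ one] g1)
  have 2: "wip A w (walk g) one = 0" by (simp add: kernel_op_selfadjoint[OF sym] walk_one g1)
  have "wip A w (walk f) f = wip A w (walk g) g + a\<^sup>2 * sum w A"
    unfolding fg by (simp add: T.add T.scale wip_linear 1 2) (simp add: walk_one oo power2_eq_square)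
  moreover have "wip A w f f = wip A w g g + a\<^sup>2 * sum w A"
    unfolding fg by (simp add: wip_linear g1 wip_commute[of _ _ one g] oo power2_eq_square)
  moreover have "(\<Sum>x\<in>A. w x * f x)\<^sup>2 / sum w A = a\<^sup>2 * sum w A"
    using M by (simp add: a_def power2_eq_square)
  moreover have "\<bar>wip A w (walk g) g\<bar> \<le> l * wip A w g g"
    using walk_quadratic_form assms g g1 by blast
  moreover have "0 \<le> l * (a\<^sup>2 * sum w A)" using assms(3) M by simp
  ultimately show ?thesis by (simp add: distrib_left)
qed (simp add: wip_def)

text \<open>Two vertices carry a nonzero mean-zero function, and the lower and upper bounds on its quadratic form
are compatible only for \<open>l \<ge> 0\<close>.\<close>

lemma spectral_bound_nonneg:
  assumes "- l \<le> smallest_eigenvalue (fun_on A) walk"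
    and "second_largest_eigenvalue (fun_on A) walk \<le> l"
    and x: "x \<in> A" and y: "y \<in> A" and "x \<noteq> y"
  shows "0 \<le> l"
proof -
  define f where "f = (\<lambda>z. if z = x then w y else if z = y then - w x else 0)"
  have f: "f \<in> fun_on A" using x y by (auto simp: f_def fun_on_def)
  have "wip A w f one = (\<Sum>z\<in>A. w z * f z)" by (simp add: wip_def)
  also have "\<dots> = (\<Sum>z\<in>{x, y}. w z * f z)"
    using fin x y by (intro sum.mono_neutral_right) (auto simp: f_def)
  also have "\<dots> = 0" using assms(5) by (simp add: f_def)
  finally have "\<bar>wip A w (walk f) f\<bar> \<le> l * wip A w f f"
    using walk_quadratic_form assms f by blast
  moreover have "f \<noteq> 0" using pos[OF y] by (auto simp: f_def fun_eq_iff)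
  then have "0 < wip A w f f" using wip_self_pos f by blast
  ultimately show ?thesis by (metis abs_ge_zero order_trans zero_le_mult_iff not_less)
qed

end

section \<open>Signless differentials on a weighted complex\<close>

locale weighted_complex =
  fixes X :: "'a set set" and m :: "'a set \<Rightarrow> real" and n :: nat
  assumes complex: "abstract_simplicial_complex X"
    and pure: "pure_complex n X"
    and weight: "weight_function n X m"
begin

text \<open>Simplices are graded by cardinality here, one more than the dimension, so that the empty simplex needs no
negative index: \<open>lev (Suc k)\<close> is the set of \<open>k\<close>-simplices and \<open>up (Suc k)\<close>, \<open>dn (Suc k)\<close> are the signless
differential on \<open>k\<close>-cochains and its adjoint, while \<open>up 0\<close> and \<open>dn 0\<close> handle constants and means.\<close>

definition lev :: "nat \<Rightarrow> 'a set set" where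
  "lev c = {\<sigma> \<in> X. card \<sigma> = c}"

definition up :: "nat \<Rightarrow> ('a set \<Rightarrow> real) \<Rightarrow> 'a set \<Rightarrow> real" where
  "up c \<phi> = (\<lambda>\<sigma>. if \<sigma> \<in> lev (Suc c) then (\<Sum>\<tau> | \<tau> \<in> lev c \<and> \<tau> \<subset> \<sigma>. \<phi> \<tau>) else 0)"

definition dn :: "nat \<Rightarrow> ('a set \<Rightarrow> real) \<Rightarrow> 'a set \<Rightarrow> real" where
  "dn c \<psi> = (\<lambda>\<tau>. if \<tau> \<in> lev c
     then (\<Sum>\<sigma> | \<sigma> \<in> lev (Suc c) \<and> \<tau> \<subset> \<sigma>. m \<sigma> * \<psi> \<sigma>) / m \<tau> else 0)"

definition lap :: "nat \<Rightarrow> ('a set \<Rightarrow> real) \<Rightarrow> 'a set \<Rightarrow> real" where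
  "lap c \<phi> = dn c (up c \<phi>)"

abbreviation ip where "ip c \<equiv> wip (lev c) m"
abbreviation nrm where "nrm c \<equiv> wnorm (lev c) m"
abbreviation const where "const c \<equiv> indicator (lev c) :: 'a set \<Rightarrow> real"

lemma finite_lev [simp]: "finite (lev c)"
  using complex by (auto simp: lev_def abstract_simplicial_complex_def)

lemma finite_face: "\<sigma> \<in> X \<Longrightarrow> finite \<sigma>"
  and subset_face: "\<sigma> \<in> X \<Longrightarrow> \<tau> \<subseteq> \<sigma> \<Longrightarrow> \<tau> \<in> X"
  using complex by (auto simp: abstract_simplicial_complex_def)

lemma empty_face: "{} \<in> X"
  using complex by (auto simp: abstract_simplicial_complex_def)

lemma faces_nat: "faces X (int k) = lev (Suc k)"
  by (auto simp: faces_def lev_def)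

lemma faces_shift: "faces X (int c - 1) = lev c"
  by (auto simp: faces_def lev_def)

lemma lev_card: "\<sigma> \<in> lev c \<Longrightarrow> card \<sigma> = c" and lev_face: "\<sigma> \<in> lev c \<Longrightarrow> \<sigma> \<in> X"
  by (simp_all add: lev_def)

lemma card_face_le: assumes "\<sigma> \<in> X" shows "card \<sigma> \<le> Suc n"
proof -
  obtain \<rho> where "\<rho> \<in> faces X (int n)" "\<sigma> \<subseteq> \<rho>" using assms pure by (auto simp: pure_complex_def)
  then show ?thesis using card_mono[OF finite_face] by (force simp: faces_nat lev_def)
qed

text \<open>The weight is only assumed positive up to dimension \<open>n\<close>; purity ensures that there are no simplices
above that dimension.\<close>

lemma m_pos: assumes "\<sigma> \<in> X" shows "0 < m \<sigma>"
proof -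
  have "\<forall>k\<in>{-1..int n}. \<forall>\<sigma>\<in>faces X k. 0 < m \<sigma>" using weight by (simp add: weight_function_def)
  moreover have "int (card \<sigma>) - 1 \<in> {-1..int n}" using card_face_le[OF assms] by auto
  moreover have "\<sigma> \<in> faces X (int (card \<sigma>) - 1)" using assms by (simp add: faces_shift lev_def)
  ultimately show ?thesis by blast
qed

lemma weight_sum:
  assumes "c \<le> n" "\<tau> \<in> lev c"
  shows "m \<tau> = (\<Sum>\<sigma> | \<sigma> \<in> lev (Suc c) \<and> \<tau> \<subset> \<sigma>. m \<sigma>)"
proof -
  have "\<forall>k\<in>{-1..int n - 1}. \<forall>\<tau>\<in>faces X k. m \<tau> = (\<Sum>\<sigma> | \<sigma> \<in> faces X (k + 1) \<and> \<tau> \<subset> \<sigma>. m \<sigma>)"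
    using weight by (simp add: weight_function_def)
  moreover have "int c - 1 \<in> {-1..int n - 1}" "\<tau> \<in> faces X (int c - 1)"
    using assms by (auto simp: faces_shift)
  ultimately have "m \<tau> = (\<Sum>\<sigma> | \<sigma> \<in> faces X (int c - 1 + 1) \<and> \<tau> \<subset> \<sigma>. m \<sigma>)"
    by blast
  then show ?thesis by (simp add: faces_nat)
qed

sublocale lv: weighted_space "lev c" m for c
  by unfold_locales (auto intro: m_pos lev_face)

lemma up_in: "up c \<phi> \<in> fun_on (lev (Suc c))" and dn_in: "dn c \<psi> \<in> fun_on (lev c)"
  by (simp_all add: up_def dn_def fun_on_def)

lemma up_linear: "module_hom fscale fscale (up c)"
  by (intro linear_operatorI) (auto simp: up_def fun_eq_iff sum.distrib sum_distrib_left)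

lemma dn_linear: "module_hom fscale fscale (dn c)"
  by (intro linear_operatorI)
    (auto simp: dn_def fun_eq_iff sum.distrib sum_distrib_left distrib_left add_divide_distrib mult_ac
        simp flip: sum_divide_distrib)

sublocale up: module_hom fscale fscale "up c" for c by (rule up_linear)
sublocale dn: module_hom fscale fscale "dn c" for c by (rule dn_linear)

lemma lap_linear: "module_hom fscale fscale (lap c)"
  by (intro linear_operatorI) (simp_all add: lap_def up.add up.scale dn.add dn.scale)

sublocale lap: module_hom fscale fscale "lap c" for c by (rule lap_linear)

lemma sum_incidence_swap:
  "(\<Sum>\<sigma>\<in>lev (Suc c). \<Sum>\<tau> | \<tau> \<in> lev c \<and> \<tau> \<subset> \<sigma>. g \<sigma> \<tau>)
    = (\<Sum>\<tau>\<in>lev c. \<Sum>\<sigma> | \<sigma> \<in> lev (Suc c) \<and> \<tau> \<subset> \<sigma>. g \<sigma> \<tau>)"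
  by (rule sum.swap_restrict) simp_all

lemma up_dn_adjoint: "ip (Suc c) (up c \<phi>) \<psi> = ip c \<phi> (dn c \<psi>)"
proof -
  have "ip (Suc c) (up c \<phi>) \<psi> = (\<Sum>\<sigma>\<in>lev (Suc c). \<Sum>\<tau> | \<tau> \<in> lev c \<and> \<tau> \<subset> \<sigma>. m \<sigma> * \<psi> \<sigma> * \<phi> \<tau>)"
    unfolding wip_def up_def by (intro sum.cong refl) (simp add: sum_distrib_left sum_distrib_right mult_ac)
  also have "\<dots> = (\<Sum>\<tau>\<in>lev c. \<Sum>\<sigma> | \<sigma> \<in> lev (Suc c) \<and> \<tau> \<subset> \<sigma>. m \<sigma> * \<psi> \<sigma> * \<phi> \<tau>)"
    by (rule sum_incidence_swap)
  also have "\<dots> = ip c \<phi> (dn c \<psi>)"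
    unfolding wip_def dn_def
  proof (intro sum.cong refl)
    fix \<tau> assume \<tau>: "\<tau> \<in> lev c"
    then have "m \<tau> \<noteq> 0" using m_pos[of \<tau>] lev_face by force
    then show "(\<Sum>\<sigma> | \<sigma> \<in> lev (Suc c) \<and> \<tau> \<subset> \<sigma>. m \<sigma> * \<psi> \<sigma> * \<phi> \<tau>) = m \<tau> * \<phi> \<tau> *
        (if \<tau> \<in> lev c then (\<Sum>\<sigma> | \<sigma> \<in> lev (Suc c) \<and> \<tau> \<subset> \<sigma>. m \<sigma> * \<psi> \<sigma>) / m \<tau> else 0)"
      using \<tau> by (simp flip: sum_distrib_right)
  qed
  finally show ?thesis .
qed

lemma lap_form: "ip c (lap c \<phi>) \<psi> = ip (Suc c) (up c \<phi>) (up c \<psi>)"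
  unfolding lap_def by (metis wip_commute up_dn_adjoint)

lemma lap_selfadjoint: "ip c (lap c \<phi>) \<psi> = ip c \<phi> (lap c \<psi>)"
  by (metis lap_form wip_commute)

lemma facets_eq:
  assumes "\<sigma> \<in> lev (Suc c)"
  shows "{\<tau> \<in> lev c. \<tau> \<subset> \<sigma>} = (\<lambda>v. \<sigma> - {v}) ` \<sigma>"
proof
  show "{\<tau> \<in> lev c. \<tau> \<subset> \<sigma>} \<subseteq> (\<lambda>v. \<sigma> - {v}) ` \<sigma>"
  proof
    fix \<tau> assume "\<tau> \<in> {\<tau> \<in> lev c. \<tau> \<subset> \<sigma>}"
    then have \<tau>: "\<tau> \<in> lev c" "\<tau> \<subset> \<sigma>" by auto
    then have "card (\<sigma> - \<tau>) = 1"
      using assms finite_face by (subst card_Diff_subset) (auto simp: lev_def intro: finite_subset)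
    then obtain v where "\<sigma> - \<tau> = {v}" by (auto simp: card_1_singleton_iff)
    then have "v \<in> \<sigma>" "\<tau> = \<sigma> - {v}" using \<tau> by auto
    then show "\<tau> \<in> (\<lambda>v. \<sigma> - {v}) ` \<sigma>" by blast
  qed
  show "(\<lambda>v. \<sigma> - {v}) ` \<sigma> \<subseteq> {\<tau> \<in> lev c. \<tau> \<subset> \<sigma>}"
    using assms finite_face by (auto simp: lev_def intro: subset_face)
qed

lemma inj_on_remove: "inj_on (\<lambda>v. \<sigma> - {v}) \<sigma>"
  by (auto simp: inj_on_def)

lemma card_facets: "\<sigma> \<in> lev (Suc c) \<Longrightarrow> card {\<tau> \<in> lev c. \<tau> \<subset> \<sigma>} = Suc c"
  by (simp add: facets_eq card_image inj_on_remove lev_card)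

lemma up_const: "up c (const c) = fscale (Suc c) (const (Suc c))"
  by (auto simp: up_def fun_eq_iff card_facets)

lemma dn_const: assumes "c \<le> n" shows "dn c (const (Suc c)) = const c"
proof
  fix \<tau>
  show "dn c (const (Suc c)) \<tau> = const c \<tau>"
  proof (cases "\<tau> \<in> lev c")
    case True
    then have "m \<tau> \<noteq> 0" using m_pos[of \<tau>] lev_face by force
    then show ?thesis using weight_sum[OF assms True] True by (simp add: dn_def)
  qed (simp add: dn_def)
qed

text \<open>Swapping the order of summation collects, for each \<open>\<tau>\<close>, the weights of its cofaces, which add up to the
weight of \<open>\<tau>\<close> by the balance condition.\<close>

lemma sum_facets_weighted:
  assumes "c \<le> n"
  shows "(\<Sum>\<sigma>\<in>lev (Suc c). \<Sum>\<tau> | \<tau> \<in> lev c \<and> \<tau> \<subset> \<sigma>. m \<sigma> * g \<tau>) = (\<Sum>\<tau>\<in>lev c. m \<tau> * g \<tau>)"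
  unfolding sum_incidence_swap sum_distrib_right[symmetric]
  by (intro sum.cong refl) (simp add: weight_sum[OF assms, symmetric])

lemma up_norm: assumes "c \<le> n" shows "nrm (Suc c) (up c \<phi>) \<le> sqrt (Suc c) * nrm c \<phi>"
proof (rule lv.wnorm_leI)
  have "ip (Suc c) (up c \<phi>) (up c \<phi>) = (\<Sum>\<sigma>\<in>lev (Suc c). m \<sigma> * (\<Sum>\<tau> | \<tau> \<in> lev c \<and> \<tau> \<subset> \<sigma>. \<phi> \<tau>)\<^sup>2)"
    unfolding wip_def up_def by (intro sum.cong refl) (simp add: power2_eq_square)
  also have "\<dots> \<le> (\<Sum>\<sigma>\<in>lev (Suc c). m \<sigma> * ((\<Sum>\<tau> | \<tau> \<in> lev c \<and> \<tau> \<subset> \<sigma>. (\<phi> \<tau>)\<^sup>2) * real (Suc c)))"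
  proof (intro sum_mono mult_left_mono)
    fix \<sigma> assume \<sigma>: "\<sigma> \<in> lev (Suc c)"
    show "(\<Sum>\<tau> | \<tau> \<in> lev c \<and> \<tau> \<subset> \<sigma>. \<phi> \<tau>)\<^sup>2 \<le> (\<Sum>\<tau> | \<tau> \<in> lev c \<and> \<tau> \<subset> \<sigma>. (\<phi> \<tau>)\<^sup>2) * real (Suc c)"
      using sum_squared_le_sum_of_squares[of \<phi> "{\<tau> \<in> lev c. \<tau> \<subset> \<sigma>}"] unfolding card_facets[OF \<sigma>] .
    show "0 \<le> m \<sigma>" using m_pos \<sigma> lev_face by (simp add: less_imp_le)
  qed
  also have "\<dots> = real (Suc c) * (\<Sum>\<sigma>\<in>lev (Suc c). \<Sum>\<tau> | \<tau> \<in> lev c \<and> \<tau> \<subset> \<sigma>. m \<sigma> * (\<phi> \<tau>)\<^sup>2)"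
    by (simp add: sum_distrib_left mult_ac)
  also have "\<dots> = real (Suc c) * ip c \<phi> \<phi>"
    unfolding sum_facets_weighted[OF assms] wip_def by (simp add: power2_eq_square mult.assoc)
  finally show "ip (Suc c) (up c \<phi>) (up c \<phi>) \<le> (sqrt (Suc c) * nrm c \<phi>)\<^sup>2"
    by (simp add: power_mult_distrib lv.wnorm_square)
qed simp

lemma dn_norm: assumes "c \<le> n" shows "nrm c (dn c \<psi>) \<le> sqrt (Suc c) * nrm (Suc c) \<psi>"
proof (cases "nrm c (dn c \<psi>) = 0")
  case False
  then have p: "0 < nrm c (dn c \<psi>)" using lv.wnorm_nonneg[of c "dn c \<psi>"] by linarith
  have "(nrm c (dn c \<psi>))\<^sup>2 = ip (Suc c) (up c (dn c \<psi>)) \<psi>"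
    by (simp add: lv.wnorm_square up_dn_adjoint)
  also have "\<dots> \<le> nrm (Suc c) (up c (dn c \<psi>)) * nrm (Suc c) \<psi>"
    using lv.cauchy_schwarz[of "Suc c" "up c (dn c \<psi>)" \<psi>] by linarith
  also have "\<dots> \<le> (sqrt (Suc c) * nrm c (dn c \<psi>)) * nrm (Suc c) \<psi>"
    by (intro mult_right_mono up_norm assms) simp
  finally show ?thesis using p by (simp add: power2_eq_square mult_ac)
qed simp

lemma lap_norm: assumes "c \<le> n" shows "nrm c (lap c \<phi>) \<le> Suc c * nrm c \<phi>"
proof -
  have "nrm c (lap c \<phi>) \<le> sqrt (Suc c) * nrm (Suc c) (up c \<phi>)"
    unfolding lap_def by (rule dn_norm[OF assms])
  also have "\<dots> \<le> sqrt (Suc c) * (sqrt (Suc c) * nrm c \<phi>)"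
    by (intro mult_left_mono up_norm assms) simp
  finally show ?thesis by (simp flip: mult.assoc)
qed

section \<open>Localization to links\<close>

definition link_vertices :: "'a set \<Rightarrow> 'a set" where
  "link_vertices \<eta> = {v. v \<notin> \<eta> \<and> insert v \<eta> \<in> X}"

text \<open>The edge weight of the link, extended by zero to pairs that are not edges, so that the walk on the link
becomes a kernel operator over all pairs of link vertices.\<close>

definition link_edge :: "'a set \<Rightarrow> 'a \<Rightarrow> 'a \<Rightarrow> real" where
  "link_edge \<eta> v w = (if v \<noteq> w \<and> v \<notin> \<eta> \<and> w \<notin> \<eta> \<and> insert v (insert w \<eta>) \<in> X
     then m (insert v (insert w \<eta>)) else 0)"

definition link_deg :: "'a set \<Rightarrow> 'a \<Rightarrow> real" where
  "link_deg \<eta> v = m (insert v \<eta>)"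

abbreviation link_walk where
  "link_walk \<eta> \<equiv> kernel_op (link_vertices \<eta>) (link_deg \<eta>) (link_edge \<eta>)"

lemma finite_link_vertices: "finite (link_vertices \<eta>)"
proof (rule finite_subset)
  show "link_vertices \<eta> \<subseteq> \<Union> X" by (auto simp: link_vertices_def)
  show "finite (\<Union> X)" using complex by (auto simp: abstract_simplicial_complex_def)
qed

lemma cofaces_eq:
  assumes "\<eta> \<in> lev c"
  shows "{\<tau> \<in> lev (Suc c). \<eta> \<subset> \<tau>} = (\<lambda>v. insert v \<eta>) ` link_vertices \<eta>"
proof
  show "{\<tau> \<in> lev (Suc c). \<eta> \<subset> \<tau>} \<subseteq> (\<lambda>v. insert v \<eta>) ` link_vertices \<eta>"
  proof
    fix \<tau> assume "\<tau> \<in> {\<tau> \<in> lev (Suc c). \<eta> \<subset> \<tau>}"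
    then have \<tau>: "\<tau> \<in> lev (Suc c)" "\<eta> \<subset> \<tau>" by auto
    then have "\<eta> \<in> {\<eta> \<in> lev c. \<eta> \<subset> \<tau>}" using assms by simp
    then obtain v where "v \<in> \<tau>" "\<eta> = \<tau> - {v}" unfolding facets_eq[OF \<tau>(1)] by blast
    then have "\<tau> = insert v \<eta>" "v \<in> link_vertices \<eta>"
      using lev_face[OF \<tau>(1)] by (auto simp: link_vertices_def insert_absorb)
    then show "\<tau> \<in> (\<lambda>v. insert v \<eta>) ` link_vertices \<eta>" by blast
  qed
  show "(\<lambda>v. insert v \<eta>) ` link_vertices \<eta> \<subseteq> {\<tau> \<in> lev (Suc c). \<eta> \<subset> \<tau>}"
    using assms finite_face by (auto simp: lev_def link_vertices_def)
qed

lemma sum_cofaces: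
  assumes "\<eta> \<in> lev c"
  shows "(\<Sum>\<tau> | \<tau> \<in> lev (Suc c) \<and> \<eta> \<subset> \<tau>. g \<tau>) = (\<Sum>v\<in>link_vertices \<eta>. g (insert v \<eta>))"
proof -
  have "inj_on (\<lambda>v. insert v \<eta>) (link_vertices \<eta>)"
    by (auto simp: inj_on_def link_vertices_def)
  then show ?thesis unfolding cofaces_eq[OF assms] by (simp add: sum.reindex)
qed

text \<open>The degree condition is the balance condition on \<open>m\<close> at the face \<open>insert v \<eta>\<close>: its cofaces are the edges of
the link at \<open>v\<close>.\<close>

lemma link_is_weighted_graph:
  assumes \<eta>: "\<eta> \<in> lev c" and c: "Suc c \<le> n"
  shows "weighted_graph (link_vertices \<eta>) (link_deg \<eta>) (link_edge \<eta>)"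
proof
  show "finite (link_vertices \<eta>)" by (rule finite_link_vertices)
  show "0 < link_deg \<eta> v" if "v \<in> link_vertices \<eta>" for v
    using that by (auto simp: link_deg_def link_vertices_def intro: m_pos)
  show "link_edge \<eta> v w = link_edge \<eta> w v" for v w
    by (auto simp: link_edge_def insert_commute)
  show "0 \<le> link_edge \<eta> v w" for v w
    by (auto simp: link_edge_def intro: less_imp_le m_pos)
  show "link_deg \<eta> v = (\<Sum>w\<in>link_vertices \<eta>. link_edge \<eta> v w)" if v: "v \<in> link_vertices \<eta>" for v
  proof -
    have lv: "insert v \<eta> \<in> lev (Suc c)"
      using v \<eta> finite_face by (auto simp: lev_def link_vertices_def)
    have sub: "link_vertices (insert v \<eta>) \<subseteq> link_vertices \<eta>"
      by (auto simp: link_vertices_def intro: subset_face)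
    have "link_deg \<eta> v = (\<Sum>w\<in>link_vertices (insert v \<eta>). m (insert w (insert v \<eta>)))"
      unfolding link_deg_def using weight_sum[OF c lv] sum_cofaces[OF lv, of m] by simp
    also have "\<dots> = (\<Sum>w\<in>link_vertices (insert v \<eta>). link_edge \<eta> v w)"
      using v by (intro sum.cong) (auto simp: link_edge_def link_vertices_def insert_commute)
    also have "\<dots> = (\<Sum>w\<in>link_vertices \<eta>. link_edge \<eta> v w)"
      using sub finite_link_vertices v
      by (intro sum.mono_neutral_left) (auto simp: link_edge_def link_vertices_def insert_commute)
    finally show ?thesis .
  qed
qed

text \<open>Local spectral expansion, expressed through the walks on links as kernel operators.\<close>

definition local_bound :: "real \<Rightarrow> bool" where
  "local_bound l \<longleftrightarrow> (\<forall>c \<eta>. Suc c \<le> n \<longrightarrow> \<eta> \<in> lev c \<longrightarrow>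
     - l \<le> smallest_eigenvalue (fun_on (link_vertices \<eta>)) (link_walk \<eta>) \<and>
     second_largest_eigenvalue (fun_on (link_vertices \<eta>)) (link_walk \<eta>) \<le> l)"

lemma vertices_link: "\<eta> \<in> X \<Longrightarrow> vertices (link X \<eta>) = link_vertices \<eta>"
  by (auto simp: vertices_def link_def faces_def link_vertices_def intro: subset_face)

lemma nonlazy_walk_link:
  assumes \<eta>: "\<eta> \<in> X"
  shows "nonlazy_walk (link X \<eta>) (link_weight m \<eta>) = link_walk \<eta>"
proof (intro ext)
  fix f v
  show "nonlazy_walk (link X \<eta>) (link_weight m \<eta>) f v = link_walk \<eta> f v"
  proof (cases "v \<in> link_vertices \<eta>")
    case True
    have edge: "{v, w} \<in> faces (link X \<eta>) 1 \<longleftrightarrow> v \<noteq> w \<and> v \<notin> \<eta> \<and> w \<notin> \<eta> \<and> insert v (insert w \<eta>) \<in> X" for w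
      by (cases "v = w") (auto simp: faces_def link_def insert_commute intro: subset_face)
    have eq: "\<eta> \<union> {v, w} = insert v (insert w \<eta>)" "\<eta> \<union> {v} = insert v \<eta>" for w by auto
    have "(\<Sum>w | {v, w} \<in> faces (link X \<eta>) 1. link_weight m \<eta> {v, w} / link_weight m \<eta> {v} * f w)
      = (\<Sum>w | {v, w} \<in> faces (link X \<eta>) 1. link_edge \<eta> v w / link_deg \<eta> v * f w)"
      by (intro sum.cong refl) (simp add: edge link_edge_def link_deg_def link_weight_def eq)
    also have "\<dots> = (\<Sum>w\<in>link_vertices \<eta>. link_edge \<eta> v w / link_deg \<eta> v * f w)"
      unfolding edge using finite_link_vertices
      by (intro sum.mono_neutral_left) (auto simp: link_edge_def link_vertices_def intro: subset_face)
    finally show ?thesis using True by (simp add: nonlazy_walk_def kernel_op_def vertices_link[OF \<eta>])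
  qed (simp add: nonlazy_walk_def kernel_op_def vertices_link[OF \<eta>])
qed

lemma local_bound_of_expander:
  assumes "two_sided_local_spectral_expander n X m l"
  shows "local_bound l"
  unfolding local_bound_def
proof (intro allI impI)
  fix c \<eta> assume c: "Suc c \<le> n" and \<eta>: "\<eta> \<in> lev c"
  have "int c - 1 \<in> {-1..int n - 2}" "\<eta> \<in> faces X (int c - 1)" using c \<eta> by (auto simp: faces_shift)
  then have "let W = fun_on (vertices (link X \<eta>)); T = nonlazy_walk (link X \<eta>) (link_weight m \<eta>)
        in - l \<le> smallest_eigenvalue W T \<and> second_largest_eigenvalue W T \<le> l"
    using assms unfolding two_sided_local_spectral_expander_def by blast
  then show "- l \<le> smallest_eigenvalue (fun_on (link_vertices \<eta>)) (link_walk \<eta>) \<and>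
     second_largest_eigenvalue (fun_on (link_vertices \<eta>)) (link_walk \<eta>) \<le> l"
    using lev_face[OF \<eta>] by (simp add: Let_def vertices_link nonlazy_walk_link)
qed

text \<open>Positivity of the weight together with the balance condition forces cofaces to exist, two steps up.\<close>

lemma link_edge_exists:
  assumes \<eta>: "\<eta> \<in> lev c" and c: "Suc c \<le> n"
  obtains v w where "v \<in> link_vertices \<eta>" "w \<in> link_vertices \<eta>" "v \<noteq> w"
proof -
  interpret weighted_graph "link_vertices \<eta>" "link_deg \<eta>" "link_edge \<eta>"
    by (rule link_is_weighted_graph[OF assms])
  have "m \<eta> > 0" using m_pos lev_face[OF \<eta>] .
  then have "(\<Sum>v\<in>link_vertices \<eta>. m (insert v \<eta>)) \<noteq> 0"
    using weight_sum[OF _ \<eta>] c sum_cofaces[OF \<eta>, of m] by simp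
  then obtain v where v: "v \<in> link_vertices \<eta>" by fastforce
  then have "(\<Sum>w\<in>link_vertices \<eta>. link_edge \<eta> v w) \<noteq> 0" using degree[OF v] pos[OF v] by simp
  then obtain w where w: "w \<in> link_vertices \<eta>" "link_edge \<eta> v w \<noteq> 0"
    by (meson sum.neutral)
  then show ?thesis using that v by (auto simp: link_edge_def split: if_splits)
qed

lemma local_bound_nonneg:
  assumes "local_bound l" "n \<ge> 1" shows "0 \<le> l"
proof -
  have e: "{} \<in> lev 0" using empty_face by (simp add: lev_def)
  interpret weighted_graph "link_vertices {}" "link_deg {}" "link_edge {}"
    using link_is_weighted_graph[OF e] assms by simp
  obtain v w where "v \<in> link_vertices {}" "w \<in> link_vertices {}" "v \<noteq> w"
    using link_edge_exists[OF e] assms by auto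
  then show ?thesis
    using spectral_bound_nonneg assms e unfolding local_bound_def by (metis One_nat_def)
qed

definition localize :: "('a set \<Rightarrow> real) \<Rightarrow> 'a set \<Rightarrow> 'a \<Rightarrow> real" where
  "localize \<phi> \<eta> = (\<lambda>v. if v \<in> link_vertices \<eta> then \<phi> (insert v \<eta>) else 0)"

text \<open>Each face of cardinality \<open>Suc c\<close> is seen from the links of its \<open>Suc c\<close> facets.\<close>

lemma sum_localize_norm:
  "(\<Sum>\<eta>\<in>lev c. wip (link_vertices \<eta>) (link_deg \<eta>) (localize \<phi> \<eta>) (localize \<phi> \<eta>)) = Suc c * ip (Suc c) \<phi> \<phi>"
proof -
  have "(\<Sum>\<eta>\<in>lev c. wip (link_vertices \<eta>) (link_deg \<eta>) (localize \<phi> \<eta>) (localize \<phi> \<eta>))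
    = (\<Sum>\<eta>\<in>lev c. \<Sum>\<tau> | \<tau> \<in> lev (Suc c) \<and> \<eta> \<subset> \<tau>. m \<tau> * \<phi> \<tau> * \<phi> \<tau>)"
    by (intro sum.cong refl) (simp add: sum_cofaces wip_def localize_def link_deg_def)
  also have "\<dots> = (\<Sum>\<tau>\<in>lev (Suc c). \<Sum>\<eta> | \<eta> \<in> lev c \<and> \<eta> \<subset> \<tau>. m \<tau> * \<phi> \<tau> * \<phi> \<tau>)"
    by (rule sum_incidence_swap[symmetric])
  also have "\<dots> = (\<Sum>\<tau>\<in>lev (Suc c). Suc c * (m \<tau> * \<phi> \<tau> * \<phi> \<tau>))"
    by (intro sum.cong refl) (simp add: card_facets)
  finally show ?thesis by (simp add: wip_def sum_distrib_left)
qed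

lemma sum_localize_mean:
  assumes "c \<le> n"
  shows "(\<Sum>\<eta>\<in>lev c. (\<Sum>v\<in>link_vertices \<eta>. link_deg \<eta> v * localize \<phi> \<eta> v)\<^sup>2 / sum (link_deg \<eta>) (link_vertices \<eta>))
    = ip c (dn c \<phi>) (dn c \<phi>)"
  unfolding wip_def
proof (intro sum.cong refl)
  fix \<eta> assume \<eta>: "\<eta> \<in> lev c"
  then have "m \<eta> \<noteq> 0" using m_pos[of \<eta>] lev_face by force
  moreover have "sum (link_deg \<eta>) (link_vertices \<eta>) = m \<eta>"
    using weight_sum[OF assms \<eta>] sum_cofaces[OF \<eta>, of m] by (simp add: link_deg_def)
  moreover have "(\<Sum>v\<in>link_vertices \<eta>. link_deg \<eta> v * localize \<phi> \<eta> v) = m \<eta> * dn c \<phi> \<eta>"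
    using \<eta> \<open>m \<eta> \<noteq> 0\<close> sum_cofaces[OF \<eta>, of "\<lambda>\<tau>. m \<tau> * \<phi> \<tau>"] by (simp add: dn_def localize_def link_deg_def)
  ultimately show "(\<Sum>v\<in>link_vertices \<eta>. link_deg \<eta> v * localize \<phi> \<eta> v)\<^sup>2 / sum (link_deg \<eta>) (link_vertices \<eta>)
      = m \<eta> * dn c \<phi> \<eta> * dn c \<phi> \<eta>"
    by (simp add: power2_eq_square)
qed

text \<open>A face \<open>\<sigma>\<close> with two distinct facets \<open>\<sigma> - {v}\<close> and \<open>\<sigma> - {w}\<close> is the same as a face \<open>\<eta> = \<sigma> - {v, w}\<close> with
an oriented edge \<open>(v, w)\<close> in its link.\<close>

lemma flags_reindex:
  fixes h :: "'a set \<Rightarrow> 'a set \<Rightarrow> 'a set \<Rightarrow> real"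
  shows "(\<Sum>\<sigma>\<in>lev (Suc (Suc c)). \<Sum>v\<in>\<sigma>. \<Sum>w\<in>\<sigma> - {v}. h \<sigma> (\<sigma> - {v}) (\<sigma> - {w}))
    = (\<Sum>\<eta>\<in>lev c. \<Sum>v\<in>link_vertices \<eta>. \<Sum>w\<in>link_vertices (insert v \<eta>).
        h (insert v (insert w \<eta>)) (insert w \<eta>) (insert v \<eta>))"
proof -
  let ?A = "SIGMA \<sigma>:lev (Suc (Suc c)). SIGMA v:\<sigma>. \<sigma> - {v}"
  let ?B = "SIGMA \<eta>:lev c. SIGMA v:link_vertices \<eta>. link_vertices (insert v \<eta>)"
  have fin: "finite \<sigma>" if "\<sigma> \<in> lev d" for \<sigma> d using that finite_face lev_face by blast
  have "(\<Sum>\<sigma>\<in>lev (Suc (Suc c)). \<Sum>v\<in>\<sigma>. \<Sum>w\<in>\<sigma> - {v}. h \<sigma> (\<sigma> - {v}) (\<sigma> - {w}))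
    = (\<Sum>(\<sigma>, v, w)\<in>?A. h \<sigma> (\<sigma> - {v}) (\<sigma> - {w}))"
    by (simp add: sum.Sigma fin split_def)
  also have "\<dots> = (\<Sum>(\<eta>, v, w)\<in>?B. h (insert v (insert w \<eta>)) (insert w \<eta>) (insert v \<eta>))"
  proof (rule sum.reindex_bij_witness[where i = "\<lambda>(\<eta>, v, w). (insert v (insert w \<eta>), v, w)"
        and j = "\<lambda>(\<sigma>, v, w). (\<sigma> - {v, w}, v, w)"], goal_cases)
    case (1 a)
    then show ?case by auto
  next
    case (2 a)
    then obtain \<sigma> v w where a: "a = (\<sigma>, v, w)" "\<sigma> \<in> X" "card \<sigma> = Suc (Suc c)" "v \<in> \<sigma>" "w \<in> \<sigma>" "v \<noteq> w"
      by (auto simp: lev_def)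
    then have "card (\<sigma> - {v, w}) = c" using finite_face[of \<sigma>] by (subst card_Diff_subset) auto
    moreover have "insert v (\<sigma> - {v, w}) \<in> X" "insert w (insert v (\<sigma> - {v, w})) \<in> X" "\<sigma> - {v, w} \<in> X"
      using a by (auto intro!: subset_face[of \<sigma>])
    ultimately show ?case using a by (auto simp: lev_def link_vertices_def)
  next
    case (3 b)
    then show ?case by (auto simp: link_vertices_def)
  next
    case (4 b)
    then obtain \<eta> v w where b: "b = (\<eta>, v, w)" "\<eta> \<in> X" "card \<eta> = c" "v \<notin> \<eta>" "w \<notin> \<eta>" "v \<noteq> w"
      "insert w (insert v \<eta>) \<in> X"
      by (auto simp: lev_def link_vertices_def)
    then show ?case using finite_face[of \<eta>] by (auto simp: lev_def insert_commute)
  next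
    case (5 a)
    then obtain \<sigma> v w where a: "a = (\<sigma>, v, w)" "v \<in> \<sigma>" "w \<in> \<sigma>" "v \<noteq> w" by auto
    then have "insert v (insert w (\<sigma> - {v, w})) = \<sigma>" "insert w (\<sigma> - {v, w}) = \<sigma> - {v}"
      "insert v (\<sigma> - {v, w}) = \<sigma> - {w}" by auto
    then show ?case using a by simp
  qed
  also have "\<dots> = (\<Sum>\<eta>\<in>lev c. \<Sum>v\<in>link_vertices \<eta>. \<Sum>w\<in>link_vertices (insert v \<eta>).
        h (insert v (insert w \<eta>)) (insert w \<eta>) (insert v \<eta>))"
    by (simp add: sum.Sigma finite_link_vertices finite_SigmaI split_def)
  finally show ?thesis .
qed

text \<open>Garland's method. The form \<open>\<langle>lap \<phi>, \<phi>\<rangle> = \<parallel>up \<phi>\<parallel>\<^sup>2\<close> expands into products \<open>\<phi> \<tau> * \<phi> \<tau>'\<close> over pairs of facets of a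
common face. The diagonal pairs contribute \<open>\<parallel>\<phi>\<parallel>\<^sup>2\<close>; a pair of distinct facets has a unique intersection
\<open>\<eta>\<close> and is an edge of the link of \<open>\<eta>\<close>, so the others contribute the walk forms of the links.\<close>

lemma lap_localization:
  assumes c: "Suc c \<le> n"
  shows "ip (Suc c) (lap (Suc c) \<phi>) \<phi> = ip (Suc c) \<phi> \<phi> +
    (\<Sum>\<eta>\<in>lev c. wip (link_vertices \<eta>) (link_deg \<eta>)
       (link_walk \<eta> (localize \<phi> \<eta>)) (localize \<phi> \<eta>))"
proof -
  have fin: "finite \<sigma>" if "\<sigma> \<in> lev d" for \<sigma> d using that finite_face lev_face by blast
  have up: "up (Suc c) \<phi> \<sigma> = (\<Sum>v\<in>\<sigma>. \<phi> (\<sigma> - {v}))" if "\<sigma> \<in> lev (Suc (Suc c))" for \<sigma>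
    using that by (simp add: up_def facets_eq sum.reindex inj_on_remove)
  have "ip (Suc c) (lap (Suc c) \<phi>) \<phi> = (\<Sum>\<sigma>\<in>lev (Suc (Suc c)). \<Sum>v\<in>\<sigma>. \<Sum>w\<in>\<sigma>. m \<sigma> * \<phi> (\<sigma> - {v}) * \<phi> (\<sigma> - {w}))"
    unfolding lap_form unfolding wip_def
    by (intro sum.cong refl) (simp add: up sum_distrib_left sum_distrib_right mult_ac)
  also have "\<dots> = (\<Sum>\<sigma>\<in>lev (Suc (Suc c)). (\<Sum>v\<in>\<sigma>. m \<sigma> * (\<phi> (\<sigma> - {v}))\<^sup>2)
      + (\<Sum>v\<in>\<sigma>. \<Sum>w\<in>\<sigma> - {v}. m \<sigma> * \<phi> (\<sigma> - {v}) * \<phi> (\<sigma> - {w})))"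
    unfolding sum.distrib[symmetric]
    by (intro sum.cong refl, subst sum.remove) (auto simp: fin power2_eq_square)
  also have "\<dots> = (\<Sum>\<sigma>\<in>lev (Suc (Suc c)). \<Sum>v\<in>\<sigma>. m \<sigma> * (\<phi> (\<sigma> - {v}))\<^sup>2)
     + (\<Sum>\<sigma>\<in>lev (Suc (Suc c)). \<Sum>v\<in>\<sigma>. \<Sum>w\<in>\<sigma> - {v}. m \<sigma> * \<phi> (\<sigma> - {v}) * \<phi> (\<sigma> - {w}))"
    by (rule sum.distrib)
  also have "(\<Sum>\<sigma>\<in>lev (Suc (Suc c)). \<Sum>v\<in>\<sigma>. m \<sigma> * (\<phi> (\<sigma> - {v}))\<^sup>2)
      = (\<Sum>\<sigma>\<in>lev (Suc (Suc c)). \<Sum>\<tau> | \<tau> \<in> lev (Suc c) \<and> \<tau> \<subset> \<sigma>. m \<sigma> * (\<phi> \<tau>)\<^sup>2)"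
    by (intro sum.cong refl) (simp add: facets_eq sum.reindex inj_on_remove)
  also have "\<dots> = ip (Suc c) \<phi> \<phi>"
    unfolding sum_facets_weighted[OF c] wip_def by (simp add: power2_eq_square mult.assoc)
  also have "(\<Sum>\<sigma>\<in>lev (Suc (Suc c)). \<Sum>v\<in>\<sigma>. \<Sum>w\<in>\<sigma> - {v}. m \<sigma> * \<phi> (\<sigma> - {v}) * \<phi> (\<sigma> - {w}))
      = (\<Sum>\<eta>\<in>lev c. \<Sum>v\<in>link_vertices \<eta>. \<Sum>w\<in>link_vertices (insert v \<eta>).
        m (insert v (insert w \<eta>)) * \<phi> (insert w \<eta>) * \<phi> (insert v \<eta>))"
    by (rule flags_reindex)
  also have "\<dots> = (\<Sum>\<eta>\<in>lev c. wip (link_vertices \<eta>) (link_deg \<eta>)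
       (link_walk \<eta> (localize \<phi> \<eta>)) (localize \<phi> \<eta>))"
  proof (intro sum.cong refl)
    fix \<eta> assume \<eta>: "\<eta> \<in> lev c"
    interpret weighted_graph "link_vertices \<eta>" "link_deg \<eta>" "link_edge \<eta>"
      by (rule link_is_weighted_graph[OF \<eta> c])
    show "(\<Sum>v\<in>link_vertices \<eta>. \<Sum>w\<in>link_vertices (insert v \<eta>).
        m (insert v (insert w \<eta>)) * \<phi> (insert w \<eta>) * \<phi> (insert v \<eta>))
      = wip (link_vertices \<eta>) (link_deg \<eta>)
       (link_walk \<eta> (localize \<phi> \<eta>)) (localize \<phi> \<eta>)"
      unfolding wip_kernel_op
    proof (rule sum.cong[OF refl])
      fix v assume v: "v \<in> link_vertices \<eta>"
      have "link_vertices (insert v \<eta>) \<subseteq> link_vertices \<eta>"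
        by (auto simp: link_vertices_def intro: subset_face)
      then show "(\<Sum>w\<in>link_vertices (insert v \<eta>). m (insert v (insert w \<eta>)) * \<phi> (insert w \<eta>) * \<phi> (insert v \<eta>))
        = (\<Sum>w\<in>link_vertices \<eta>. link_edge \<eta> v w * localize \<phi> \<eta> w * localize \<phi> \<eta> v)"
        using v finite_link_vertices
        by (intro sum.mono_neutral_cong_left)
          (auto simp: localize_def link_edge_def link_vertices_def insert_commute)
    qed
  qed
  finally show ?thesis .
qed

text \<open>The difference between the upper and lower Laplacians, up to the identity. It would vanish if every walk on
a link were the projection onto constants.\<close>

definition discrepancy :: "nat \<Rightarrow> ('a set \<Rightarrow> real) \<Rightarrow> 'a set \<Rightarrow> real" where
  "discrepancy c \<phi> = lap (Suc c) \<phi> - \<phi> - up c (dn c \<phi>)"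

text \<open>The form of \<open>up (dn \<phi>)\<close> is \<open>\<parallel>dn \<phi>\<parallel>\<^sup>2\<close>, which localizes to the projections of \<open>\<phi>\<close> onto constants in the
links. After this cancellation, only the spectra of the walks on mean-zero functions remain, and these
are bounded by \<open>l\<close>.\<close>

lemma discrepancy_norm:
  assumes l: "local_bound l" and c: "Suc c \<le> n"
  shows "nrm (Suc c) (discrepancy c \<phi>) \<le> (real c + 1) * l * nrm (Suc c) \<phi>"
proof (rule lv.selfadjoint_norm_le)
  show "module_hom fscale fscale (discrepancy c)"
    by (intro linear_operatorI)
      (simp_all add: discrepancy_def lap.add up.add dn.add lap.scale up.scale dn.scale
        fs.scale_right_diff_distrib)
  show "ip (Suc c) (discrepancy c f) g = ip (Suc c) f (discrepancy c g)" for f g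
    using up_dn_adjoint[of c "dn c f" g] up_dn_adjoint[of c "dn c g" f] wip_commute[of _ m "dn c f" "dn c g"]
      wip_commute[of _ m f "up c (dn c g)"]
    by (simp add: discrepancy_def wip_linear lap_selfadjoint)
  have l0: "0 \<le> l" using local_bound_nonneg[OF l] c by simp
  show "\<bar>ip (Suc c) (discrepancy c f) f\<bar> \<le> (real c + 1) * l * ip (Suc c) f f" for f
  proof -
    let ?T = "\<lambda>\<eta>. wip (link_vertices \<eta>) (link_deg \<eta>)
       (link_walk \<eta> (localize f \<eta>)) (localize f \<eta>)"
    let ?M = "\<lambda>\<eta>. (\<Sum>v\<in>link_vertices \<eta>. link_deg \<eta> v * localize f \<eta> v)\<^sup>2 / sum (link_deg \<eta>) (link_vertices \<eta>)"
    have "\<bar>ip (Suc c) (discrepancy c f) f\<bar> = \<bar>\<Sum>\<eta>\<in>lev c. ?T \<eta> - ?M \<eta>\<bar>"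
      using lap_localization[OF c, of f] sum_localize_mean[of c f] c
      by (simp add: discrepancy_def wip_linear up_dn_adjoint sum_subtractf)
    also have "\<dots> \<le> (\<Sum>\<eta>\<in>lev c. \<bar>?T \<eta> - ?M \<eta>\<bar>)" by (rule sum_abs)
    also have "\<dots> \<le> (\<Sum>\<eta>\<in>lev c. l * wip (link_vertices \<eta>) (link_deg \<eta>) (localize f \<eta>) (localize f \<eta>))"
    proof (intro sum_mono)
      fix \<eta> assume \<eta>: "\<eta> \<in> lev c"
      interpret weighted_graph "link_vertices \<eta>" "link_deg \<eta>" "link_edge \<eta>"
        by (rule link_is_weighted_graph[OF \<eta> c])
      have "localize f \<eta> \<in> fun_on (link_vertices \<eta>)" by (simp add: localize_def fun_on_def)
      then show "\<bar>?T \<eta> - ?M \<eta>\<bar> \<le> l * wip (link_vertices \<eta>) (link_deg \<eta>) (localize f \<eta>) (localize f \<eta>)"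
        using l \<eta> c l0 unfolding local_bound_def by (intro walk_minus_mean_form) blast+
    qed
    also have "\<dots> = (real c + 1) * l * ip (Suc c) f f"
      unfolding sum_distrib_left[symmetric] sum_localize_norm by simp
    finally show ?thesis .
  qed
qed

end

section \<open>The filtration and its orthogonal decomposition\<close>

context weighted_complex
begin

lemma cochains_eq: "cochains X k = fun_on (lev (Suc k))"
  by (simp add: cochains_def faces_nat)

lemma cinner_eq: "cinner X m k = ip (Suc k)"
  by (simp add: fun_eq_iff cinner_def wip_def faces_nat)

lemma cnorm_eq: "cnorm X m k = nrm (Suc k)"
  by (simp add: fun_eq_iff cnorm_def wnorm_def cinner_eq)

lemma cochains0_eq: "cochains0 X m k = {\<phi> \<in> fun_on (lev (Suc k)). ip (Suc k) \<phi> (const (Suc k)) = 0}"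
  by (simp add: cochains0_def cochains_eq faces_nat wip_def)

lemma dsl_eq: "dsl X k = up (Suc k)"
proof -
  have "faces X (int k + 1) = lev (Suc (Suc k))" using faces_nat[of "Suc k"] by (simp add: add.commute)
  then show ?thesis by (simp add: fun_eq_iff dsl_def up_def faces_nat)
qed

text \<open>The adjoint is unique because the difference of two candidates at \<open>\<psi>\<close> is itself an admissible test cochain.\<close>

lemma dsl_adj_eq:
  assumes "\<psi> \<in> cochains X (k + 1)"
  shows "dsl_adj X m k \<psi> = dn (Suc k) \<psi>"
proof -
  let ?T = "restrict (dn (Suc k)) (cochains X (k + 1))"
  have "dsl_adj X m k = ?T"
    unfolding dsl_adj_def
  proof (rule the_equality)
    show "?T \<in> cochains X (k + 1) \<rightarrow>\<^sub>E cochains X k \<and>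
     (\<forall>\<phi>\<in>cochains X k. \<forall>\<psi>\<in>cochains X (k + 1).
        cinner X m (k + 1) (dsl X k \<phi>) \<psi> = cinner X m k \<phi> (?T \<psi>))"
      by (auto simp: cochains_eq dn_in cinner_eq dsl_eq up_dn_adjoint)
  next
    fix T assume T: "T \<in> cochains X (k + 1) \<rightarrow>\<^sub>E cochains X k \<and>
     (\<forall>\<phi>\<in>cochains X k. \<forall>\<psi>\<in>cochains X (k + 1).
        cinner X m (k + 1) (dsl X k \<phi>) \<psi> = cinner X m k \<phi> (T \<psi>))"
    show "T = ?T"
    proof
      fix \<psi>
      show "T \<psi> = ?T \<psi>"
      proof (cases "\<psi> \<in> cochains X (k + 1)")
        case True
        let ?u = "T \<psi> - dn (Suc k) \<psi>"
        have u: "?u \<in> fun_on (lev (Suc k))"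
          using T True dn_in by (intro fs.subspace_diff[OF subspace_fun_on]) (auto simp: cochains_eq)
        have "ip (Suc k) ?u (T \<psi>) = ip (Suc k) ?u (dn (Suc k) \<psi>)"
          using T True u by (simp add: cochains_eq cinner_eq dsl_eq up_dn_adjoint)
        then have "ip (Suc k) ?u ?u = 0" by (simp add: wip_diff_right)
        then have "?u = 0" by (rule lv.wip_self_eq_0[OF u])
        then show ?thesis using True by simp
      next
        case False
        moreover have "T \<psi> = undefined" using T False PiE_arb by blast
        ultimately show ?thesis by simp
      qed
    qed
  qed
  then show ?thesis using assms by simp
qed

text \<open>Two distinct faces of the same cardinality lie in at most one common coface, their union; on the diagonal
the weights of all cofaces sum to the weight of the face.\<close>

lemma upper_walk_eq:
  assumes k: "k < n"
  shows "fscale (real k + 2) (upper_walk X m k \<phi>) = lap (Suc k) \<phi>"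
proof
  fix \<tau>
  show "fscale (real k + 2) (upper_walk X m k \<phi>) \<tau> = lap (Suc k) \<phi> \<tau>"
  proof (cases "\<tau> \<in> lev (Suc k)")
    case \<tau>: True
    then have fin\<tau>: "finite \<tau>" and card\<tau>: "card \<tau> = Suc k" and m\<tau>: "m \<tau> > 0"
      using finite_face lev_face lev_card m_pos by blast+
    have K: "upper_walk_kernel X m k \<tau> \<tau>' * (real k + 2)
        = (\<Sum>\<sigma> | \<sigma> \<in> lev (Suc (Suc k)) \<and> \<tau> \<subset> \<sigma> \<and> \<tau>' \<subset> \<sigma>. m \<sigma>) / m \<tau>" if \<tau>': "\<tau>' \<in> lev (Suc k)" for \<tau>'
    proof (cases "\<tau> = \<tau>'")
      case True
      then show ?thesis using weight_sum[OF _ \<tau>] m\<tau> k by (simp add: upper_walk_kernel_def)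
    next
      case False
      have fin\<tau>': "finite \<tau>'" and card\<tau>': "card \<tau>' = Suc k"
        using \<tau>' finite_face lev_face lev_card by blast+
      have sub: "\<tau> \<subset> \<tau> \<union> \<tau>'" "\<tau>' \<subset> \<tau> \<union> \<tau>'"
        using False card_subset_eq[OF fin\<tau>, of \<tau>'] card_subset_eq[OF fin\<tau>', of \<tau>] card\<tau> card\<tau>' by auto
      have "\<sigma> = \<tau> \<union> \<tau>'" if \<sigma>: "\<sigma> \<in> lev (Suc (Suc k))" "\<tau> \<subset> \<sigma>" "\<tau>' \<subset> \<sigma>" for \<sigma>
      proof -
        have fin: "finite \<sigma>" using \<sigma>(1) finite_face lev_face by blast
        have "Suc k < card (\<tau> \<union> \<tau>')" using psubset_card_mono[OF _ sub(1)] fin\<tau> fin\<tau>' card\<tau> by simp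
        moreover have "\<tau> \<union> \<tau>' \<subseteq> \<sigma>" using \<sigma> by auto
        ultimately show ?thesis using card_seteq[OF fin, of "\<tau> \<union> \<tau>'"] lev_card[OF \<sigma>(1)] by simp
      qed
      then have "{\<sigma>. \<sigma> \<in> lev (Suc (Suc k)) \<and> \<tau> \<subset> \<sigma> \<and> \<tau>' \<subset> \<sigma>}
          = {\<sigma>. \<sigma> = \<tau> \<union> \<tau>' \<and> \<tau> \<union> \<tau>' \<in> lev (Suc (Suc k))}"
        using sub by blast
      then have "{\<sigma>. \<sigma> \<in> lev (Suc (Suc k)) \<and> \<tau> \<subset> \<sigma> \<and> \<tau>' \<subset> \<sigma>}
          = (if \<tau> \<union> \<tau>' \<in> lev (Suc (Suc k)) then {\<tau> \<union> \<tau>'} else {})"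
        by simp
      moreover have "faces X (int k + 1) = lev (Suc (Suc k))"
        using faces_nat[of "Suc k"] by (simp add: add.commute)
      ultimately show ?thesis using False by (simp add: upper_walk_kernel_def)
    qed
    have "lap (Suc k) \<phi> \<tau> = (\<Sum>\<sigma> | \<sigma> \<in> lev (Suc (Suc k)) \<and> \<tau> \<subset> \<sigma>.
        \<Sum>\<tau>' | \<tau>' \<in> lev (Suc k) \<and> \<tau>' \<subset> \<sigma>. m \<sigma> * \<phi> \<tau>') / m \<tau>"
      using \<tau> by (simp add: lap_def dn_def up_def sum_distrib_left)
    also have "(\<Sum>\<sigma> | \<sigma> \<in> lev (Suc (Suc k)) \<and> \<tau> \<subset> \<sigma>. \<Sum>\<tau>' | \<tau>' \<in> lev (Suc k) \<and> \<tau>' \<subset> \<sigma>. m \<sigma> * \<phi> \<tau>')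
        = (\<Sum>\<tau>'\<in>lev (Suc k). \<Sum>\<sigma> | \<sigma> \<in> {\<sigma> \<in> lev (Suc (Suc k)). \<tau> \<subset> \<sigma>} \<and> \<tau>' \<subset> \<sigma>. m \<sigma> * \<phi> \<tau>')"
      by (rule sum.swap_restrict) simp_all
    also have "\<dots> / m \<tau> = (\<Sum>\<tau>'\<in>lev (Suc k). upper_walk_kernel X m k \<tau> \<tau>' * (real k + 2) * \<phi> \<tau>')"
      unfolding sum_divide_distrib
      by (intro sum.cong refl) (simp add: K sum_distrib_right conj_assoc sum_divide_distrib)
    also have "\<dots> = fscale (real k + 2) (upper_walk X m k \<phi>) \<tau>"
      using \<tau> by (simp add: upper_walk_def faces_nat sum_distrib_left mult_ac)
    finally show ?thesis by simp
  qed (simp add: upper_walk_def faces_nat lap_def dn_def)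
qed

text \<open>Cochains of degree \<open>k\<close> coming from mean-zero cochains of degree \<open>j\<close>. Including the case \<open>j = k\<close>, where it
is the space of all mean-zero cochains, makes the spaces \<open>filt k j\<close> an increasing filtration with
\<open>Usp X m k j\<close> as its successive orthogonal complements, so that one argument covers all \<open>j\<close>.\<close>

definition filt :: "nat \<Rightarrow> nat \<Rightarrow> ('a set \<Rightarrow> real) set" where
  "filt k j = dsl_iter X j (k - j) ` cochains0 X m j"

lemma filt_self: "filt k k = cochains0 X m k"
  by (simp add: filt_def)

lemma filt_Suc: "j \<le> k \<Longrightarrow> filt (Suc k) j = up (Suc k) ` filt k j"
  by (simp add: filt_def Suc_diff_le dsl_eq image_image)

lemma subspace_cochains0: "fs.subspace (cochains0 X m k)"
  using subspace_wip_orthogonal[of "lev (Suc k)" "{const (Suc k)}" m] by (simp add: cochains0_eq)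

lemma subspace_filt: "j \<le> k \<Longrightarrow> fs.subspace (filt k j)"
proof (induction k)
  case (Suc k)
  show ?case
  proof (cases "j = Suc k")
    case True
    then show ?thesis using subspace_cochains0 filt_self by metis
  next
    case False
    then have "j \<le> k" using Suc.prems by simp
    then show ?thesis using up.subspace_image Suc.IH filt_Suc by metis
  qed
qed (use subspace_cochains0 filt_self in \<open>metis le_zero_eq\<close>)

lemma up_mean_zero:
  assumes "k < n" "\<phi> \<in> cochains0 X m k"
  shows "up (Suc k) \<phi> \<in> cochains0 X m (Suc k)"
  using assms by (simp add: cochains0_eq up_in up_dn_adjoint dn_const)

lemma filt_mono: "j < k \<Longrightarrow> k \<le> n \<Longrightarrow> filt k j \<subseteq> filt k (Suc j)"
proof (induction k)
  case (Suc k)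
  show ?case
  proof (cases "j = k")
    case True
    then show ?thesis using Suc up_mean_zero by (auto simp: filt_Suc filt_self)
  next
    case False
    then show ?thesis using Suc by (auto simp: filt_Suc)
  qed
qed simp

lemma filt_le: "i \<le> j \<Longrightarrow> j \<le> k \<Longrightarrow> k \<le> n \<Longrightarrow> filt k i \<subseteq> filt k j"
proof (induction j)
  case (Suc j)
  then show ?case using filt_mono[of j k] by (cases "i = Suc j") auto
qed simp

lemma filt_cochains: "j \<le> k \<Longrightarrow> k \<le> n \<Longrightarrow> filt k j \<subseteq> fun_on (lev (Suc k))"
  using filt_le[of j k k] by (auto simp: filt_self cochains0_eq)

text \<open>The kernel of an adjoint is the orthogonal complement of the range. Every cochain is the
sum of a mean-zero cochain and a constant, and \<open>up\<close> maps constants to constants; orthogonality to the latter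
is the mean-zero condition.\<close>

lemma kernel_dn_eq:
  assumes "Suc k \<le> n"
  shows "{\<phi> \<in> cochains X (Suc k). dsl_adj X m k \<phi> = 0}
    = {\<phi> \<in> filt (Suc k) (Suc k). \<forall>\<psi>\<in>filt (Suc k) k. ip (Suc (Suc k)) \<phi> \<psi> = 0}"
proof (intro set_eqI iffI)
  fix \<phi> assume "\<phi> \<in> {\<phi> \<in> cochains X (Suc k). dsl_adj X m k \<phi> = 0}"
  then have \<phi>: "\<phi> \<in> fun_on (lev (Suc (Suc k)))" "dn (Suc k) \<phi> = 0"
    using dsl_adj_eq[of \<phi> k] by (auto simp: cochains_eq)
  have orth: "ip (Suc (Suc k)) \<phi> (up (Suc k) \<psi>) = 0" for \<psi>
    by (subst wip_commute) (simp add: up_dn_adjoint \<phi>)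
  have "real (Suc (Suc k)) * ip (Suc (Suc k)) \<phi> (const (Suc (Suc k))) = 0"
    using orth[of "const (Suc k)"] by (simp only: up_const wip_scale_right)
  then have "ip (Suc (Suc k)) \<phi> (const (Suc (Suc k))) = 0" by simp
  then show "\<phi> \<in> {\<phi> \<in> filt (Suc k) (Suc k). \<forall>\<psi>\<in>filt (Suc k) k. ip (Suc (Suc k)) \<phi> \<psi> = 0}"
    using \<phi> orth by (auto simp: filt_self cochains0_eq filt_Suc)
next
  fix \<phi> assume \<phi>: "\<phi> \<in> {\<phi> \<in> filt (Suc k) (Suc k). \<forall>\<psi>\<in>filt (Suc k) k. ip (Suc (Suc k)) \<phi> \<psi> = 0}"
  then have \<phi>0: "\<phi> \<in> fun_on (lev (Suc (Suc k)))" "ip (Suc (Suc k)) \<phi> (const (Suc (Suc k))) = 0"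
    by (auto simp: filt_self cochains0_eq)
  define \<xi> where "\<xi> = dn (Suc k) \<phi>"
  have "ip (Suc k) \<xi> (const (Suc k)) = ip (Suc (Suc k)) (up (Suc k) (const (Suc k))) \<phi>"
    unfolding \<xi>_def up_dn_adjoint by (rule wip_commute)
  also have "\<dots> = 0"
    unfolding up_const wip_commute[of _ _ _ \<phi>] wip_scale_right \<phi>0(2) by simp
  finally have "\<xi> \<in> filt k k" by (simp add: filt_self cochains0_eq \<xi>_def dn_in)
  then have "ip (Suc (Suc k)) \<phi> (up (Suc k) \<xi>) = 0" using \<phi> by (auto simp: filt_Suc)
  then have "ip (Suc k) \<xi> \<xi> = 0"
    by (metis \<xi>_def up_dn_adjoint wip_commute)
  then have "\<xi> = 0" by (intro lv.wip_self_eq_0) (simp_all add: \<xi>_def dn_in)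
  then show "\<phi> \<in> {\<phi> \<in> cochains X (Suc k). dsl_adj X m k \<phi> = 0}"
    using \<phi>0(1) dsl_adj_eq[of \<phi> k] by (simp add: cochains_eq \<xi>_def)
qed

lemma Vsp_eq: "j < k \<Longrightarrow> Vsp X m k j = filt k j"
  by (simp add: Vsp_def filt_def)

lemma Usp_eq:
  assumes "j \<le> k" "k \<le> n"
  shows "Usp X m k j = {\<phi> \<in> filt k j. j \<noteq> 0 \<longrightarrow> (\<forall>\<psi>\<in>filt k (j - 1). ip (Suc k) \<phi> \<psi> = 0)}"
proof -
  consider "j = 0" "k = 0" | "j = 0" "0 < k" | "0 < j" "j < k" | "j = k" "0 < k" using assms by linarith
  then show ?thesis
  proof cases
    case 1
    then show ?thesis by (simp add: Usp_def Vsp_def filt_def)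
  next
    case 2
    then show ?thesis by (simp add: Usp_def Vsp_eq)
  next
    case 3
    then show ?thesis using filt_cochains[of j k] assms
      by (auto simp: Usp_def Vsp_eq orth_compl_def cinner_eq cochains_eq)
  next
    case 4
    then obtain k' where "k = Suc k'" using gr0_implies_Suc by blast
    then show ?thesis using 4 kernel_dn_eq[of k'] assms by (simp add: Usp_def Vsp_def)
  qed
qed

lemma Usp_orthogonal:
  assumes "i \<le> k" "j \<le> k" "k \<le> n" "i \<noteq> j" "\<phi> \<in> Usp X m k i" "\<psi> \<in> Usp X m k j"
  shows "ip (Suc k) \<phi> \<psi> = 0"
proof -
  have *: "ip (Suc k) \<psi> \<phi> = 0" if "i < j" "j \<le> k" "\<phi> \<in> Usp X m k i" "\<psi> \<in> Usp X m k j" for i j \<phi> \<psi>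
  proof -
    have "\<phi> \<in> filt k i" using that assms(3) by (auto simp: Usp_eq)
    then have "\<phi> \<in> filt k (j - 1)" using filt_le[of i "j - 1" k] that(1,2) assms(3) by (simp add: subset_iff)
    then show ?thesis using that assms(3) by (auto simp: Usp_eq)
  qed
  show ?thesis
    using *[of i j \<phi> \<psi>] *[of j i \<psi> \<phi>] assms wip_commute[of _ m \<phi> \<psi>] by (metis linorder_neqE_nat)
qed

lemma filt_split:
  assumes "Suc j \<le> k" "k \<le> n" "\<phi> \<in> filt k (Suc j)"
  obtains \<theta> \<psi> where "\<theta> \<in> filt k j" "\<psi> \<in> Usp X m k (Suc j)" "\<phi> = \<theta> + \<psi>"
proof -
  obtain \<theta> where \<theta>: "\<theta> \<in> filt k j" "\<And>h. h \<in> filt k j \<Longrightarrow> ip (Suc k) (\<phi> - \<theta>) h = 0"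
    using lv.projection_exists[OF subspace_filt filt_cochains] assms by (metis Suc_leD)
  have "\<theta> \<in> filt k (Suc j)" using \<theta>(1) filt_mono[of j k] assms(1,2) by auto
  then have "\<phi> - \<theta> \<in> Usp X m k (Suc j)"
    using \<theta> assms subspace_filt by (auto simp: Usp_eq intro: fs.subspace_diff)
  then show ?thesis using that \<theta> by force
qed

lemma filt_decomposition:
  assumes "j \<le> k" "k \<le> n" "\<phi> \<in> filt k j"
  shows "\<exists>\<psi>. (\<forall>i\<le>j. \<psi> i \<in> Usp X m k i) \<and> \<phi> = (\<Sum>i\<le>j. \<psi> i)"
  using assms
proof (induction j arbitrary: \<phi>)
  case 0
  then show ?case by (intro exI[of _ "\<lambda>_. \<phi>"]) (simp add: Usp_eq)
next
  case (Suc j)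
  obtain \<theta> \<xi> where *: "\<theta> \<in> filt k j" "\<xi> \<in> Usp X m k (Suc j)" "\<phi> = \<theta> + \<xi>"
    using filt_split Suc.prems by blast
  then obtain \<psi> where \<psi>: "\<forall>i\<le>j. \<psi> i \<in> Usp X m k i" "\<theta> = (\<Sum>i\<le>j. \<psi> i)"
    using Suc.IH[of \<theta>] Suc.prems by auto
  have eq: "(\<Sum>i\<le>j. (\<psi>(Suc j := \<xi>)) i) = (\<Sum>i\<le>j. \<psi> i)" by (intro sum.cong) auto
  show ?case
  proof (intro exI conjI)
    show "\<forall>i\<le>Suc j. (\<psi>(Suc j := \<xi>)) i \<in> Usp X m k i" using \<psi>(1) *(2) by (simp add: le_Suc_eq)
    show "\<phi> = (\<Sum>i\<le>Suc j. (\<psi>(Suc j := \<xi>)) i)"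
      unfolding sum.atMost_Suc eq using * \<psi>(2) by simp
  qed
qed

section \<open>Almost eigenvectors of the upper Laplacian\<close>

definition approx_spectrum :: "real \<Rightarrow> nat \<Rightarrow> bool" where
  "approx_spectrum e k \<longleftrightarrow> (\<forall>j\<le>k. \<forall>\<phi>\<in>Usp X m k j.
     nrm (Suc k) (lap (Suc k) \<phi> - fscale (real k + 1 - real j) \<phi>) \<le> e * nrm (Suc k) \<phi>)"

lemma approx_spectrum_sum:
  assumes ap: "approx_spectrum e k" and "0 \<le> e" "j \<le> k" "k \<le> n"
    and \<psi>: "\<forall>i\<le>j. \<psi> i \<in> Usp X m k i"
  shows "nrm (Suc k) (lap (Suc k) (\<Sum>i\<le>j. \<psi> i) - (\<Sum>i\<le>j. fscale (real k + 1 - real i) (\<psi> i)))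
    \<le> sqrt (real j + 1) * e * nrm (Suc k) (\<Sum>i\<le>j. \<psi> i)"
proof -
  have "nrm (Suc k) (lap (Suc k) (\<Sum>i\<le>j. \<psi> i) - (\<Sum>i\<le>j. fscale (real k + 1 - real i) (\<psi> i)))
      \<le> sqrt (card {..j}) * e * nrm (Suc k) (\<Sum>i\<le>j. \<psi> i)"
  proof (rule lv.almost_eigenvector_sum[OF lap_linear _ assms(2)])
    show "ip (Suc k) (\<psi> i) (\<psi> i') = 0" if "i \<in> {..j}" "i' \<in> {..j}" "i \<noteq> i'" for i i'
      using that assms by (intro Usp_orthogonal[of i k i']) auto
    show "nrm (Suc k) (lap (Suc k) (\<psi> i) - fscale (real k + 1 - real i) (\<psi> i)) \<le> e * nrm (Suc k) (\<psi> i)"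
      if "i \<in> {..j}" for i
      using ap \<psi> that assms(3) unfolding approx_spectrum_def by auto
  qed simp
  then show ?thesis by (simp add: add.commute)
qed

text \<open>On \<open>filt k j\<close> the integers \<open>k + 1 - i\<close> that occur are at least \<open>k + 1 - j\<close>.\<close>

lemma lap_lower_bound:
  assumes ap: "approx_spectrum e k" and e: "0 \<le> e" and jk: "j \<le> k" "k \<le> n" and \<phi>: "\<phi> \<in> filt k j"
  shows "(real k + 1 - real j - sqrt (real k + 1) * e) * ip (Suc k) \<phi> \<phi> \<le> ip (Suc k) (lap (Suc k) \<phi>) \<phi>"
proof -
  obtain \<psi> where \<psi>: "\<forall>i\<le>j. \<psi> i \<in> Usp X m k i" "\<phi> = (\<Sum>i\<le>j. \<psi> i)"
    using filt_decomposition[OF jk \<phi>] by blast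
  let ?S = "\<Sum>i\<le>j. fscale (real k + 1 - real i) (\<psi> i)"
  have orth: "ip (Suc k) (\<psi> i) (\<psi> i') = 0" if "i \<in> {..j}" "i' \<in> {..j}" "i \<noteq> i'" for i i'
    using that \<psi> jk by (intro Usp_orthogonal[of i k i']) auto
  have one: "\<phi> = (\<Sum>i\<le>j. fscale 1 (\<psi> i))" using \<psi>(2) by (simp add: fscale_def)
  have "\<bar>ip (Suc k) (lap (Suc k) \<phi> - ?S) \<phi>\<bar> \<le> nrm (Suc k) (lap (Suc k) \<phi> - ?S) * nrm (Suc k) \<phi>"
    by (rule lv.cauchy_schwarz)
  also have "\<dots> \<le> (sqrt (real j + 1) * e * nrm (Suc k) \<phi>) * nrm (Suc k) \<phi>"
    using approx_spectrum_sum[OF ap e jk \<psi>(1)] unfolding \<psi>(2)[symmetric]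
    by (intro mult_right_mono) auto
  also have "\<dots> = sqrt (real j + 1) * e * ip (Suc k) \<phi> \<phi>"
    by (simp add: lv.wnorm_square[symmetric] power2_eq_square mult.assoc)
  also have "\<dots> \<le> sqrt (real k + 1) * e * ip (Suc k) \<phi> \<phi>"
    using jk e lv.wip_self_nonneg by (intro mult_right_mono) auto
  finally have "ip (Suc k) ?S \<phi> - sqrt (real k + 1) * e * ip (Suc k) \<phi> \<phi> \<le> ip (Suc k) (lap (Suc k) \<phi>) \<phi>"
    unfolding wip_diff_left by linarith
  moreover have "(real k + 1 - real j) * ip (Suc k) \<phi> \<phi> \<le> ip (Suc k) ?S \<phi>"
  proof -
    have "ip (Suc k) ?S \<phi> = (\<Sum>i\<le>j. (real k + 1 - real i) * 1 * ip (Suc k) (\<psi> i) (\<psi> i))"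
      by (subst one, rule lv.wip_orthogonal_sum) (auto intro: orth)
    moreover have "ip (Suc k) (\<Sum>i\<le>j. fscale 1 (\<psi> i)) (\<Sum>i\<le>j. fscale 1 (\<psi> i))
        = (\<Sum>i\<le>j. 1 * 1 * ip (Suc k) (\<psi> i) (\<psi> i))"
      by (rule lv.wip_orthogonal_sum) (auto intro: orth)
    ultimately show ?thesis unfolding one[symmetric]
      by (auto simp: sum_distrib_left intro!: sum_mono mult_right_mono lv.wip_self_nonneg)
  qed
  ultimately show ?thesis by (simp add: left_diff_distrib)
qed

lemma discrepancy_zero_dn:
  "dn c \<phi> = 0 \<Longrightarrow> discrepancy c \<phi> = lap (Suc c) \<phi> - \<phi>"
  by (simp add: discrepancy_def up.zero)

text \<open>The left-hand side is the error produced by the induction step at \<open>K = k + 1\<close>, the right-hand side the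
contribution of the previous error in the recursion for \<open>eps\<close>. Here \<open>sqrt (2(K + 1)) \<le> 2 sqrt K\<close> and the sum in
parentheses is at most \<open>3 K e\<close>; equality holds throughout for \<open>K = 1\<close>.\<close>

lemma error_arithmetic:
  fixes K :: nat and e :: real
  assumes "1 \<le> K" "0 \<le> e"
  shows "sqrt (real K + 1) * (sqrt 2 * (e + (2 * real K + 1) * (2 / 3 * e)))
    \<le> 2 * real K * (1 + 2 * real K * sqrt (real K)) * e"
proof -
  let ?s = "sqrt (real K)"
  have K: "1 \<le> real K" using assms by simp
  have s: "1 \<le> ?s" using K by simp
  have "sqrt (real K + 1) * sqrt 2 = sqrt (2 * (real K + 1))"
    by (simp only: real_sqrt_mult mult.commute)
  also have "\<dots> \<le> sqrt (4 * real K)" using K by simp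
  also have "\<dots> = 2 * ?s" by (simp add: real_sqrt_mult)
  finally have "sqrt (real K + 1) * sqrt 2 * (e + (2 * real K + 1) * (2 / 3 * e)) \<le> 2 * ?s * (3 * real K * e)"
  proof (rule mult_mono)
    have "real K * e \<ge> e" using K assms mult_right_mono[of 1 "real K" e] by simp
    moreover have "e + (2 * real K + 1) * (2 / 3 * e) = 5 / 3 * e + 4 / 3 * (real K * e)"
      by (simp add: field_simps)
    ultimately show "e + (2 * real K + 1) * (2 / 3 * e) \<le> 3 * real K * e" by linarith
  qed (use assms K in auto)
  also have "\<dots> = 2 * real K * (3 * ?s) * e" by simp
  also have "\<dots> \<le> 2 * real K * (1 + 2 * real K * ?s) * e"
  proof (intro mult_right_mono mult_left_mono)
    show "3 * ?s \<le> 1 + 2 * real K * ?s"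
    proof (cases "K = 1")
      case False
      then have "3 * ?s \<le> 2 * real K * ?s" using assms by (intro mult_right_mono) auto
      then show ?thesis by simp
    qed simp
  qed (use assms in auto)
  finally show ?thesis by (simp add: mult.assoc)
qed

text \<open>The heart of the induction. Write \<open>\<phi> = up \<psi>\<close> with \<open>\<psi>\<close> in \<open>filt k j\<close> and \<open>\<psi> = \<theta> + \<psi>'\<close> with \<open>\<psi>'\<close> in the \<open>j\<close>-th
summand and \<open>\<theta>\<close> in \<open>filt k (j - 1)\<close>, or \<open>\<theta> = 0\<close> if \<open>j = 0\<close>.
Since \<open>up (dn \<phi>) = up (lap \<psi>)\<close>, it suffices that \<open>lap \<psi>\<close> is close to \<open>(k + 1 - j) \<psi>\<close>. This holds for \<open>\<psi>'\<close>; and \<open>\<theta>\<close> is small because \<open>\<phi>\<close> is orthogonal to \<open>up \<theta>\<close>, that is,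
\<open>\<langle>lap \<theta>, \<theta>\<rangle> = -\<langle>lap \<psi>', \<theta>\<rangle>\<close>: the left side is at least \<open>3/2 \<parallel>\<theta>\<parallel>\<^sup>2\<close>, while \<open>\<theta>\<close> and \<open>\<psi>'\<close> being orthogonal makes
the right side of order \<open>e\<close>. Finally \<open>\<parallel>\<psi>\<parallel>\<close> is controlled by \<open>\<parallel>\<phi>\<parallel>\<close> since \<open>\<parallel>up \<psi>\<parallel>\<^sup>2 \<ge> \<parallel>\<psi>\<parallel>\<^sup>2 / 2\<close>.\<close>

lemma up_dn_near_integer:
  assumes ap: "approx_spectrum e k" and e: "0 \<le> e" and small: "sqrt (real k + 1) * e \<le> 1 / 2"
    and k: "Suc k \<le> n" and j: "j \<le> k" and \<phi>: "\<phi> \<in> Usp X m (Suc k) j"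
  shows "nrm (Suc (Suc k)) (up (Suc k) (dn (Suc k) \<phi>) - fscale (real k + 1 - real j) \<phi>)
    \<le> 2 * (real k + 1) * (1 + 2 * (real k + 1) * sqrt (real k + 1)) * e * nrm (Suc (Suc k)) \<phi>"
proof -
  let ?N = "nrm (Suc k)" and ?c = "real k + 1 - real j"
  have kn: "k \<le> n" using k by simp
  obtain \<psi> where \<psi>: "\<psi> \<in> filt k j" "\<phi> = up (Suc k) \<psi>"
    using \<phi> j k by (auto simp: Usp_eq filt_Suc)
  obtain \<theta> \<psi>' where \<theta>: "\<psi>' \<in> Usp X m k j" "\<psi> = \<theta> + \<psi>'" "ip (Suc k) \<psi>' \<theta> = 0"
    "\<theta> = 0 \<or> (0 < j \<and> \<theta> \<in> filt k (j - 1))"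
  proof (cases j)
    case 0
    then show ?thesis using that[of \<psi> 0] \<psi> kn by (simp add: Usp_eq)
  next
    case (Suc i)
    then obtain \<theta> \<xi> where "\<theta> \<in> filt k i" "\<xi> \<in> Usp X m k (Suc i)" "\<psi> = \<theta> + \<xi>"
      using filt_split[of i k \<psi>] j kn \<psi> by blast
    then show ?thesis using that[of \<xi> \<theta>] Suc j kn by (auto simp: Usp_eq)
  qed
  have \<psi>'b: "?N (lap (Suc k) \<psi>' - fscale ?c \<psi>') \<le> e * ?N \<psi>'"
    using ap \<theta>(1) j unfolding approx_spectrum_def by blast
  have pyth: "ip (Suc k) \<psi> \<psi> = ip (Suc k) \<theta> \<theta> + ip (Suc k) \<psi>' \<psi>'"
    unfolding \<theta>(2) using \<theta>(3) by (simp add: wip_linear wip_commute[of _ _ \<theta> \<psi>'])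
  have le\<psi>: "?N \<psi>' \<le> ?N \<psi>"
    unfolding wnorm_def pyth using lv.wip_self_nonneg by simp
  have \<theta>b: "?N \<theta> \<le> 2 / 3 * e * ?N \<psi>"
  proof (cases "?N \<theta> = 0")
    case False
    then have p: "0 < ?N \<theta>" using lv.wnorm_nonneg[of "Suc k" \<theta>] by linarith
    then have "\<theta> \<noteq> 0" by auto
    then have j0: "0 < j" and \<theta>F: "\<theta> \<in> filt k (j - 1)" using \<theta>(4) by auto
    have "ip (Suc (Suc k)) \<phi> (up (Suc k) \<theta>) = 0"
      using \<phi> j0 \<theta>F j k by (auto simp: Usp_eq filt_Suc)
    then have "ip (Suc k) (lap (Suc k) \<psi>) \<theta> = 0" by (simp add: lap_form \<psi>(2))
    then have "ip (Suc k) (lap (Suc k) \<theta>) \<theta> = - ip (Suc k) (lap (Suc k) \<psi>') \<theta>"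
      unfolding \<theta>(2) lap.add wip_add_left by linarith
    also have "\<dots> = - ip (Suc k) (lap (Suc k) \<psi>' - fscale ?c \<psi>') \<theta>"
      by (simp add: wip_linear \<theta>(3))
    also have "\<dots> \<le> ?N (lap (Suc k) \<psi>' - fscale ?c \<psi>') * ?N \<theta>"
      using lv.cauchy_schwarz[of "Suc k" "lap (Suc k) \<psi>' - fscale ?c \<psi>'" \<theta>] by linarith
    also have "\<dots> \<le> (e * ?N \<psi>) * ?N \<theta>"
      using \<psi>'b mult_left_mono[OF le\<psi> e] by (intro mult_right_mono) auto
    finally have up: "ip (Suc k) (lap (Suc k) \<theta>) \<theta> \<le> e * ?N \<psi> * ?N \<theta>" .
    \<comment> \<open>The integer of the earlier filtration step is at least 2, and the error is at most 1/2.\<close>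
    have "3 / 2 * ip (Suc k) \<theta> \<theta> \<le> (real k + 1 - real (j - 1) - sqrt (real k + 1) * e) * ip (Suc k) \<theta> \<theta>"
      using j0 j small lv.wip_self_nonneg by (intro mult_right_mono) (auto simp: of_nat_diff)
    also have "\<dots> \<le> ip (Suc k) (lap (Suc k) \<theta>) \<theta>"
      using lap_lower_bound[OF ap e _ kn \<theta>F] j by simp
    finally have "3 / 2 * (?N \<theta>)\<^sup>2 \<le> e * ?N \<psi> * ?N \<theta>" using up by (simp add: lv.wnorm_square)
    then have "3 / 2 * ?N \<theta> \<le> e * ?N \<psi>" using p by (simp add: power2_eq_square)
    then show ?thesis by simp
  qed (use e in simp)
  have N\<psi>: "?N \<psi> \<le> sqrt 2 * nrm (Suc (Suc k)) \<phi>"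
  proof (rule lv.wnorm_leI)
    have "1 / 2 * ip (Suc k) \<psi> \<psi> \<le> (real k + 1 - real j - sqrt (real k + 1) * e) * ip (Suc k) \<psi> \<psi>"
      using j small lv.wip_self_nonneg by (intro mult_right_mono) auto
    also have "\<dots> \<le> ip (Suc k) (lap (Suc k) \<psi>) \<psi>" by (rule lap_lower_bound[OF ap e j kn \<psi>(1)])
    finally show "ip (Suc k) \<psi> \<psi> \<le> (sqrt 2 * nrm (Suc (Suc k)) \<phi>)\<^sup>2"
      by (simp add: power_mult_distrib lv.wnorm_square lap_form \<psi>(2))
  qed simp
  define \<rho> where "\<rho> = lap (Suc k) \<psi> - fscale ?c \<psi>"
  have "?N \<rho> \<le> ?N (lap (Suc k) \<psi>' - fscale ?c \<psi>') + ?N (lap (Suc k) \<theta> - fscale ?c \<theta>)"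
  proof -
    have "\<rho> = (lap (Suc k) \<psi>' - fscale ?c \<psi>') + (lap (Suc k) \<theta> - fscale ?c \<theta>)"
      unfolding \<rho>_def \<theta>(2) lap.add fs.scale_right_distrib by simp
    then show ?thesis using lv.wnorm_triangle by metis
  qed
  also have "?N (lap (Suc k) \<theta> - fscale ?c \<theta>) \<le> (2 * real (Suc k) + 1) * ?N \<theta>"
  proof -
    have "?N (lap (Suc k) \<theta> - fscale ?c \<theta>) \<le> ?N (lap (Suc k) \<theta>) + ?N (fscale ?c \<theta>)"
      by (rule lv.wnorm_triangle_diff)
    moreover have "?N (lap (Suc k) \<theta>) \<le> (real k + 2) * ?N \<theta>"
      using lap_norm[of "Suc k" \<theta>] k by (simp add: add.commute)
    moreover have "?N (fscale ?c \<theta>) \<le> (real k + 1) * ?N \<theta>"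
      unfolding lv.wnorm_scale using j by (intro mult_right_mono) auto
    ultimately show ?thesis by (simp add: algebra_simps)
  qed
  also have "(2 * real (Suc k) + 1) * ?N \<theta> \<le> (2 * real (Suc k) + 1) * (2 / 3 * e * ?N \<psi>)"
    using \<theta>b by (intro mult_left_mono) auto
  also have "?N (lap (Suc k) \<psi>' - fscale ?c \<psi>') \<le> e * ?N \<psi>"
    using \<psi>'b mult_left_mono[OF le\<psi> e] by linarith
  finally have "?N \<rho> \<le> e * ?N \<psi> + (2 * real (Suc k) + 1) * (2 / 3 * e * ?N \<psi>)"
    by simp
  also have "\<dots> = (e + (2 * real (Suc k) + 1) * (2 / 3 * e)) * ?N \<psi>"
    by (simp only: distrib_right mult.assoc)
  also have "\<dots> \<le> (e + (2 * real (Suc k) + 1) * (2 / 3 * e)) * (sqrt 2 * nrm (Suc (Suc k)) \<phi>)"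
    using N\<psi> e by (intro mult_left_mono) auto
  finally have \<rho>: "?N \<rho> \<le> (e + (2 * real (Suc k) + 1) * (2 / 3 * e)) * (sqrt 2 * nrm (Suc (Suc k)) \<phi>)" .
  have "up (Suc k) (dn (Suc k) \<phi>) - fscale ?c \<phi> = up (Suc k) \<rho>"
    unfolding \<rho>_def \<psi>(2) up.diff up.scale lap_def ..
  then have "nrm (Suc (Suc k)) (up (Suc k) (dn (Suc k) \<phi>) - fscale ?c \<phi>) \<le> sqrt (real (Suc k) + 1) * ?N \<rho>"
    using up_norm[of "Suc k" \<rho>] k by (simp add: add.commute)
  also have "\<dots> \<le> sqrt (real (Suc k) + 1) * ((e + (2 * real (Suc k) + 1) * (2 / 3 * e)) * (sqrt 2 * nrm (Suc (Suc k)) \<phi>))"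
    by (intro mult_left_mono \<rho>) auto
  also have "\<dots> = sqrt (real (Suc k) + 1) * (sqrt 2 * (e + (2 * real (Suc k) + 1) * (2 / 3 * e))) * nrm (Suc (Suc k)) \<phi>"
    by (simp only: mult_ac)
  also have "\<dots> \<le> 2 * real (Suc k) * (1 + 2 * real (Suc k) * sqrt (real (Suc k))) * e * nrm (Suc (Suc k)) \<phi>"
    by (intro mult_right_mono error_arithmetic e) auto
  finally show ?thesis by (simp add: add.commute)
qed

text \<open>For a mean-zero function on vertices, the projection onto constants \<open>up 0 (dn 0 \<phi>)\<close> vanishes.\<close>

lemma approx_spectrum_0:
  assumes "local_bound l" "1 \<le> n"
  shows "approx_spectrum l 0"
  unfolding approx_spectrum_def
proof (intro allI impI ballI)
  fix j \<phi> assume j: "j \<le> (0::nat)" and "\<phi> \<in> Usp X m 0 j"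
  then have \<phi>: "\<phi> \<in> fun_on (lev (Suc 0))" "ip (Suc 0) \<phi> (const (Suc 0)) = 0"
    by (auto simp: Usp_eq filt_self cochains0_eq)
  have "ip 0 (dn 0 \<phi>) (const 0) = 0"
    using up_dn_adjoint[of 0 "const 0" \<phi>] \<phi>(2)
    by (simp add: wip_commute[of _ _ _ \<phi>] wip_commute[of _ _ _ "dn 0 \<phi>"] up_const wip_scale_right)
  moreover have "lev 0 = {{}}" using empty_face finite_face by (auto simp: lev_def)
  ultimately have "dn 0 \<phi> {} = 0" using m_pos[OF empty_face] by (simp add: wip_def)
  then have "dn 0 \<phi> = 0" using \<open>lev 0 = {{}}\<close> by (auto simp: dn_def fun_eq_iff)
  then show "nrm (Suc 0) (lap (Suc 0) \<phi> - fscale (real 0 + 1 - real j) \<phi>) \<le> l * nrm (Suc 0) \<phi>"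
    using discrepancy_norm[OF assms(1), of 0 \<phi>] assms(2) j by (simp add: discrepancy_zero_dn)
qed

text \<open>Up to the discrepancy, the upper Laplacian is the identity plus \<open>up \<circ> dn\<close>. The latter kills the last summand
and is close to an integer multiple of the identity on each of the others.\<close>

lemma approx_spectrum_Suc:
  assumes l: "local_bound l" and ap: "approx_spectrum e k" and e: "0 \<le> e"
    and small: "sqrt (real k + 1) * e \<le> 1 / 2" and k: "Suc (Suc k) \<le> n"
  shows "approx_spectrum (2 * (real k + 1) * (1 + 2 * (real k + 1) * sqrt (real k + 1)) * e + (real k + 2) * l) (Suc k)"
  unfolding approx_spectrum_def
proof (intro allI impI ballI)
  fix j \<phi> assume j: "j \<le> Suc k" and \<phi>: "\<phi> \<in> Usp X m (Suc k) j"
  let ?N = "nrm (Suc (Suc k))" and ?c = "real k + 1 - real j"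
  let ?E = "2 * (real k + 1) * (1 + 2 * (real k + 1) * sqrt (real k + 1)) * e"
  have E: "0 \<le> ?E" using e by simp
  have shift: "?N (up (Suc k) (dn (Suc k) \<phi>) - fscale ?c \<phi>) \<le> ?E * ?N \<phi>"
  proof (cases "j = Suc k")
    case True
    then have "\<phi> \<in> {\<phi> \<in> cochains X (Suc k). dsl_adj X m k \<phi> = 0}"
      using \<phi> k by (subst kernel_dn_eq) (auto simp: Usp_eq)
    then have "dn (Suc k) \<phi> = 0" using dsl_adj_eq[of \<phi> k] by auto
    then show ?thesis using True E by (simp add: up.zero)
  next
    case False
    then show ?thesis using up_dn_near_integer[OF ap e small _ _ \<phi>] j k by simp
  qed
  have "lap (Suc (Suc k)) \<phi> - fscale (real (Suc k) + 1 - real j) \<phi>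
      = (up (Suc k) (dn (Suc k) \<phi>) - fscale ?c \<phi>) + discrepancy (Suc k) \<phi>"
    by (auto simp: discrepancy_def fun_eq_iff algebra_simps)
  then have "?N (lap (Suc (Suc k)) \<phi> - fscale (real (Suc k) + 1 - real j) \<phi>)
      \<le> ?N (up (Suc k) (dn (Suc k) \<phi>) - fscale ?c \<phi>) + ?N (discrepancy (Suc k) \<phi>)"
    using lv.wnorm_triangle by metis
  moreover have "?N (discrepancy (Suc k) \<phi>) \<le> (real k + 2) * l * ?N \<phi>"
    using discrepancy_norm[OF l k, of \<phi>] by (simp add: add.commute)
  ultimately show "?N (lap (Suc (Suc k)) \<phi> - fscale (real (Suc k) + 1 - real j) \<phi>)
     \<le> (?E + (real k + 2) * l) * ?N \<phi>"
    using shift unfolding distrib_right[of ?E] by linarith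
qed

lemma eps_nonneg: "0 \<le> l \<Longrightarrow> 0 \<le> eps l k"
  by (induction k) auto

text \<open>The error \<open>sqrt (k + 1) * e\<close> stays below half the gap between consecutive integers, which separates the
summands and makes the Laplacian bounded below on mean-zero cochains.\<close>

lemma small_eps:
  fixes e :: real and k :: nat
  assumes "e \<le> 1 / (2 * (1 + 2 * (real k + 1) * sqrt (real k + 1)))"
  shows "sqrt (real k + 1) * e < 1 / 2"
proof -
  let ?s = "sqrt (real k + 1)" and ?D = "1 + 2 * (real k + 1) * sqrt (real k + 1)"
  have s: "0 < ?s" by simp
  have "1 * ?s \<le> 2 * (real k + 1) * ?s" using s by (intro mult_right_mono) auto
  then have D: "?s < ?D" "0 < ?D" using s by linarith+
  have "?s * e \<le> ?s * (1 / (2 * ?D))" using assms s by (intro mult_left_mono) auto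
  also have "\<dots> = ?s / ?D / 2" by simp
  also have "\<dots> < 1 / 2" using D by (intro divide_strict_right_mono) (auto simp: pos_divide_less_eq)
  finally show ?thesis .
qed

lemma approx_spectrum_eps:
  assumes "local_bound l" "1 \<le> n"
    and "\<forall>k. k + 2 \<le> n \<longrightarrow> eps l k \<le> 1 / (2 * (1 + 2 * (real k + 1) * sqrt (real k + 1)))"
    and "k < n"
  shows "approx_spectrum (eps l k) k"
  using assms(4)
proof (induction k)
  case 0
  then show ?case using approx_spectrum_0 assms by simp
next
  case (Suc k)
  have "sqrt (real k + 1) * eps l k \<le> 1 / 2"
    using small_eps[of "eps l k" k] assms(3) Suc.prems by auto
  then show ?case
    using approx_spectrum_Suc[OF assms(1) Suc.IH eps_nonneg] local_bound_nonneg[OF assms(1,2)] Suc.prems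
    by (simp add: add.commute add.left_commute)
qed

section \<open>Eigenvalues and eigenvectors\<close>

text \<open>For an eigenvector \<open>\<phi>\<close> with components \<open>\<psi> i\<close>, the almost eigenvector estimate for \<open>\<phi>\<close> becomes an estimate
for a weighted sum of the squared norms of its components.\<close>

lemma eigenvector_decomposition:
  assumes ap: "approx_spectrum e k" and e: "0 \<le> e" and k: "k \<le> n"
    and \<phi>: "\<phi> = (\<Sum>i\<le>k. \<psi> i)" and \<psi>: "\<forall>i\<le>k. \<psi> i \<in> Usp X m k i"
    and eig: "lap (Suc k) \<phi> = fscale \<kappa> \<phi>"
  shows "(\<Sum>i\<le>k. (\<kappa> - (real k + 1 - real i))\<^sup>2 * ip (Suc k) (\<psi> i) (\<psi> i))
    \<le> (sqrt (real k + 1) * e)\<^sup>2 * ip (Suc k) \<phi> \<phi>"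
proof -
  let ?D = "\<Sum>i\<le>k. fscale (\<kappa> - (real k + 1 - real i)) (\<psi> i)"
  have "lap (Suc k) \<phi> - (\<Sum>i\<le>k. fscale (real k + 1 - real i) (\<psi> i)) = ?D"
    unfolding eig unfolding \<phi> fs.scale_sum_right sum_subtractf[symmetric]
    by (simp add: fs.scale_left_diff_distrib)
  then have "nrm (Suc k) ?D \<le> sqrt (real k + 1) * e * nrm (Suc k) \<phi>"
    using approx_spectrum_sum[OF ap e order_refl k \<psi>] unfolding \<phi>[symmetric] by simp
  then have "(nrm (Suc k) ?D)\<^sup>2 \<le> (sqrt (real k + 1) * e * nrm (Suc k) \<phi>)\<^sup>2"
    by (intro power_mono) auto
  moreover have "ip (Suc k) ?D ?D = (\<Sum>i\<le>k. (\<kappa> - (real k + 1 - real i)) * (\<kappa> - (real k + 1 - real i)) * ip (Suc k) (\<psi> i) (\<psi> i))"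
    using Usp_orthogonal k \<psi> by (intro lv.wip_orthogonal_sum) auto
  ultimately show ?thesis
    by (simp only: lv.wnorm_square power_mult_distrib power2_eq_square[of "\<kappa> - _"])
qed

lemma component_norm_sum:
  assumes k: "k \<le> n" and \<phi>: "\<phi> = (\<Sum>i\<le>k. \<psi> i)" and \<psi>: "\<forall>i\<le>k. \<psi> i \<in> Usp X m k i"
  shows "ip (Suc k) \<phi> \<phi> = (\<Sum>i\<le>k. ip (Suc k) (\<psi> i) (\<psi> i))"
proof -
  have "ip (Suc k) (\<Sum>i\<le>k. fscale 1 (\<psi> i)) (\<Sum>i\<le>k. fscale 1 (\<psi> i)) = (\<Sum>i\<le>k. 1 * 1 * ip (Suc k) (\<psi> i) (\<psi> i))"
    using Usp_orthogonal k \<psi> by (intro lv.wip_orthogonal_sum) auto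
  then show ?thesis by (simp add: \<phi> fscale_def)
qed

text \<open>If \<open>\<kappa>\<close> were far from all the integers, every coefficient in the weighted sum of squared norms would be too
large.\<close>

lemma eigenvalue_near_integer:
  assumes ap: "approx_spectrum e k" and e: "0 \<le> e" and k: "k \<le> n"
    and \<phi>: "\<phi> \<in> cochains0 X m k" "\<phi> \<noteq> 0" and eig: "lap (Suc k) \<phi> = fscale \<kappa> \<phi>"
  shows "\<exists>j\<le>k. \<bar>\<kappa> - (real k + 1 - real j)\<bar> \<le> sqrt (real k + 1) * e"
proof (rule ccontr)
  assume "\<not> ?thesis"
  then have far: "sqrt (real k + 1) * e < \<bar>\<kappa> - (real k + 1 - real j)\<bar>" if "j \<le> k" for j
    using that not_le by blast
  have \<phi>F: "\<phi> \<in> filt k k" using \<phi> by (simp add: filt_self)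
  obtain \<psi> where \<psi>: "\<forall>i\<le>k. \<psi> i \<in> Usp X m k i" "\<phi> = (\<Sum>i\<le>k. \<psi> i)"
    using filt_decomposition[OF order_refl k \<phi>F] by blast
  have pos: "0 < ip (Suc k) \<phi> \<phi>" using lv.wip_self_pos \<phi> by (auto simp: cochains0_eq)
  have sq: "(sqrt (real k + 1) * e)\<^sup>2 < (\<kappa> - (real k + 1 - real j))\<^sup>2" if "j \<le> k" for j
    using power_strict_mono[OF far[OF that], of 2] e by simp
  have "\<exists>i\<le>k. 0 < ip (Suc k) (\<psi> i) (\<psi> i)"
  proof (rule ccontr)
    assume "\<not> ?thesis"
    then have "(\<Sum>i\<le>k. ip (Suc k) (\<psi> i) (\<psi> i)) \<le> 0" by (intro sum_nonpos) auto
    then show False using pos component_norm_sum[OF k \<psi>(2,1)] by simp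
  qed
  then obtain i where i: "i \<le> k" "0 < ip (Suc k) (\<psi> i) (\<psi> i)" by blast
  have "(sqrt (real k + 1) * e)\<^sup>2 * ip (Suc k) \<phi> \<phi> = (\<Sum>i\<le>k. (sqrt (real k + 1) * e)\<^sup>2 * ip (Suc k) (\<psi> i) (\<psi> i))"
    unfolding component_norm_sum[OF k \<psi>(2,1)] sum_distrib_left ..
  also have "\<dots> < (\<Sum>i\<le>k. (\<kappa> - (real k + 1 - real i))\<^sup>2 * ip (Suc k) (\<psi> i) (\<psi> i))"
  proof (rule sum_strict_mono_ex1)
    show "\<forall>x\<in>{..k}. (sqrt (real k + 1) * e)\<^sup>2 * ip (Suc k) (\<psi> x) (\<psi> x) \<le> (\<kappa> - (real k + 1 - real x))\<^sup>2 * ip (Suc k) (\<psi> x) (\<psi> x)"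
      using sq by (auto intro!: mult_right_mono lv.wip_self_nonneg intro: less_imp_le)
    show "\<exists>a\<in>{..k}. (sqrt (real k + 1) * e)\<^sup>2 * ip (Suc k) (\<psi> a) (\<psi> a) < (\<kappa> - (real k + 1 - real a))\<^sup>2 * ip (Suc k) (\<psi> a) (\<psi> a)"
      using i sq by (intro bexI[of _ i]) auto
  qed simp
  also have "\<dots> \<le> (sqrt (real k + 1) * e)\<^sup>2 * ip (Suc k) \<phi> \<phi>"
    by (rule eigenvector_decomposition[OF ap e k \<psi>(2,1) eig])
  finally show False by simp
qed

text \<open>The difference \<open>\<phi> - \<psi> j\<close> is the sum of the other components, hence orthogonal to the summand. Uniqueness
holds because a vector of the summand that is orthogonal to the summand vanishes.\<close>

lemma orth_proj_component:
  assumes k: "k \<le> n" and \<phi>: "\<phi> = (\<Sum>i\<le>k. \<psi> i)" and \<psi>: "\<forall>i\<le>k. \<psi> i \<in> Usp X m k i" and j: "j \<le> k"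
  shows "orth_proj X m k (Usp X m k j) \<phi> = \<psi> j"
  unfolding orth_proj_def cinner_eq
proof (rule the_equality)
  have diff: "\<phi> - \<psi> j = (\<Sum>i\<in>{..k} - {j}. \<psi> i)" using j by (simp add: \<phi> sum_diff1)
  have orth: "ip (Suc k) (\<phi> - \<psi> j) \<theta> = 0" if "\<theta> \<in> Usp X m k j" for \<theta>
    unfolding diff wip_sum_left
  proof (intro sum.neutral ballI)
    fix i assume "i \<in> {..k} - {j}"
    then show "ip (Suc k) (\<psi> i) \<theta> = 0" using that \<psi> k j by (intro Usp_orthogonal[of i k j]) auto
  qed
  then show "\<psi> j \<in> Usp X m k j \<and> (\<forall>\<theta>\<in>Usp X m k j. ip (Suc k) (\<phi> - \<psi> j) \<theta> = 0)"
    using \<psi> j by auto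
  fix \<xi> assume \<xi>: "\<xi> \<in> Usp X m k j \<and> (\<forall>\<theta>\<in>Usp X m k j. ip (Suc k) (\<phi> - \<xi>) \<theta> = 0)"
  have "\<psi> j \<in> Usp X m k j" using \<psi> j by auto
  then have "ip (Suc k) (\<xi> - \<psi> j) \<xi> = 0" "ip (Suc k) (\<xi> - \<psi> j) (\<psi> j) = 0"
    using orth \<xi> by (fastforce simp: wip_diff_left)+
  then have "ip (Suc k) (\<xi> - \<psi> j) (\<xi> - \<psi> j) = 0" by (simp add: wip_diff_right)
  moreover have "\<xi> - \<psi> j \<in> fun_on (lev (Suc k))"
    using \<xi> \<open>\<psi> j \<in> Usp X m k j\<close> filt_cochains[OF j k] j k
    by (intro fs.subspace_diff[OF subspace_fun_on]) (auto simp: Usp_eq)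
  ultimately have "\<xi> - \<psi> j = 0" using lv.wip_self_eq_0 by blast
  then show "\<xi> = \<psi> j" by simp
qed

text \<open>If \<open>\<kappa>\<close> is within \<open>\<delta> = sqrt (k + 1) * e\<close> of one of the integers, it has distance at least \<open>1 - \<delta>\<close> from the
others, so the other components together have norm at most \<open>\<delta>/(1 - \<delta>) \<parallel>\<phi>\<parallel>\<close>.\<close>

lemma eigenvector_near_component:
  assumes ap: "approx_spectrum e k" and e: "0 \<le> e" and k: "k \<le> n"
    and small: "sqrt (real k + 1) * e < 1"
    and \<phi>: "\<phi> \<in> cochains0 X m k" and eig: "lap (Suc k) \<phi> = fscale \<kappa> \<phi>"
    and j: "j \<le> k" "\<bar>\<kappa> - (real k + 1 - real j)\<bar> \<le> sqrt (real k + 1) * e"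
  shows "nrm (Suc k) (\<phi> - orth_proj X m k (Usp X m k j) \<phi>)
    \<le> sqrt (real k + 1) * e / (1 - sqrt (real k + 1) * e) * nrm (Suc k) \<phi>"
proof -
  define \<delta> where "\<delta> = sqrt (real k + 1) * e"
  have \<delta>: "0 \<le> \<delta>" "\<delta> < 1" using e small by (auto simp: \<delta>_def)
  have \<phi>F: "\<phi> \<in> filt k k" using \<phi> by (simp add: filt_self)
  obtain \<psi> where \<psi>: "\<forall>i\<le>k. \<psi> i \<in> Usp X m k i" "\<phi> = (\<Sum>i\<le>k. \<psi> i)"
    using filt_decomposition[OF order_refl k \<phi>F] by blast
  let ?I = "{..k} - {j}"
  have diff: "\<phi> - \<psi> j = (\<Sum>i\<in>?I. fscale 1 (\<psi> i))" using j by (simp add: \<psi>(2) sum_diff1 fscale_def)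
  have "(1 - \<delta>)\<^sup>2 * ip (Suc k) (\<phi> - \<psi> j) (\<phi> - \<psi> j) = (\<Sum>i\<in>?I. (1 - \<delta>)\<^sup>2 * ip (Suc k) (\<psi> i) (\<psi> i))"
  proof -
    have "ip (Suc k) (\<phi> - \<psi> j) (\<phi> - \<psi> j) = (\<Sum>i\<in>?I. 1 * 1 * ip (Suc k) (\<psi> i) (\<psi> i))"
      unfolding diff using Usp_orthogonal k \<psi>(1) by (intro lv.wip_orthogonal_sum) auto
    then show ?thesis by (simp add: sum_distrib_left)
  qed
  also have "\<dots> \<le> (\<Sum>i\<in>?I. (\<kappa> - (real k + 1 - real i))\<^sup>2 * ip (Suc k) (\<psi> i) (\<psi> i))"
  proof (intro sum_mono mult_right_mono lv.wip_self_nonneg)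
    fix i assume "i \<in> ?I"
    then have "1 \<le> \<bar>real i - real j\<bar>" by (cases i j rule: linorder_cases) auto
    then have "1 - \<delta> \<le> \<bar>\<kappa> - (real k + 1 - real i)\<bar>" using j(2) unfolding \<delta>_def[symmetric] by linarith
    then show "(1 - \<delta>)\<^sup>2 \<le> (\<kappa> - (real k + 1 - real i))\<^sup>2"
      using \<delta> power_mono[of "1 - \<delta>" "\<bar>\<kappa> - (real k + 1 - real i)\<bar>" 2] by simp
  qed
  also have "\<dots> \<le> (\<Sum>i\<le>k. (\<kappa> - (real k + 1 - real i))\<^sup>2 * ip (Suc k) (\<psi> i) (\<psi> i))"
    by (intro sum_mono2) (auto simp: lv.wip_self_nonneg)
  also have "\<dots> \<le> \<delta>\<^sup>2 * ip (Suc k) \<phi> \<phi>"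
    unfolding \<delta>_def by (rule eigenvector_decomposition[OF ap e k \<psi>(2,1) eig])
  finally have "((1 - \<delta>) * nrm (Suc k) (\<phi> - \<psi> j))\<^sup>2 \<le> (\<delta> * nrm (Suc k) \<phi>)\<^sup>2"
    by (simp add: power_mult_distrib lv.wnorm_square)
  then have "(1 - \<delta>) * nrm (Suc k) (\<phi> - \<psi> j) \<le> \<delta> * nrm (Suc k) \<phi>"
    by (rule power2_le_imp_le) (rule mult_nonneg_nonneg[OF \<delta>(1) lv.wnorm_nonneg])
  then show ?thesis
    using \<delta> unfolding orth_proj_component[OF k \<psi>(2,1) j(1)] \<delta>_def[symmetric] by (simp add: field_simps)
qed

text \<open>The constants are eigenvectors for \<open>k + 2\<close>, so all other eigenvectors are orthogonal to them.\<close>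

lemma eigenvector_mean_zero:
  assumes k: "k < n" and \<phi>: "\<phi> \<in> cochains X k" and eig: "lap (Suc k) \<phi> = fscale \<kappa> \<phi>" and "\<kappa> \<noteq> real k + 2"
  shows "\<phi> \<in> cochains0 X m k"
proof -
  have "lap (Suc k) (const (Suc k)) = fscale (real k + 2) (const (Suc k))"
    using k by (simp add: lap_def up_const dn.scale dn_const add.commute)
  then have "ip (Suc k) \<phi> (const (Suc k)) = 0"
    using lv.eigenvectors_orthogonal[OF lap_selfadjoint eig] assms(4) by blast
  then show ?thesis using \<phi> by (simp add: cochains0_eq cochains_eq)
qed

lemma eps_interval_iff:
  "\<mu> \<in> eps_interval l k j \<longleftrightarrow> \<bar>(real k + 2) * \<mu> - (real k + 1 - real j)\<bar> \<le> sqrt (real k + 1) * eps l k"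
proof -
  have "a / c - s / c * e \<le> \<mu> \<longleftrightarrow> a - s * e \<le> c * \<mu>" "\<mu> \<le> a / c + s / c * e \<longleftrightarrow> c * \<mu> \<le> a + s * e"
    if "0 < c" for a c s e :: real
  proof -
    have "a / c - s / c * e = (a - s * e) / c" "a / c + s / c * e = (a + s * e) / c"
      by (simp_all add: diff_divide_distrib add_divide_distrib)
    then show "a / c - s / c * e \<le> \<mu> \<longleftrightarrow> a - s * e \<le> c * \<mu>" "\<mu> \<le> a / c + s / c * e \<longleftrightarrow> c * \<mu> \<le> a + s * e"
      using that by (simp_all add: pos_divide_le_eq pos_le_divide_eq mult.commute)
  qed
  note * = this[of "real k + 2"]
  have "0 < real k + 2" by simp
  show ?thesis unfolding eps_interval_def atLeastAtMost_iff abs_le_iff *[OF \<open>0 < real k + 2\<close>] by linarith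
qed

end

theorem theorem5p9:
  fixes X :: "'a set set" and m :: "'a set \<Rightarrow> real" and n :: nat and l :: real
  assumes "n \<ge> 1"
    and "abstract_simplicial_complex X"
    and "pure_complex n X"
    and "weight_function n X m"
    and "two_sided_local_spectral_expander n X m l"
    and "\<forall>k. k + 2 \<le> n \<longrightarrow>
           eps l k \<le> 1 / (2 * (1 + 2 * (real k + 1) * sqrt (real k + 1)))"
    and "eps l (n - 1) < 1 / (2 * sqrt (real n))"
  shows "\<forall>k \<le> n - 1.
      Spec (cochains X k) (upper_walk X m k) \<subseteq> {1} \<union> (\<Union>j\<in>{0..k}. eps_interval l k j) \<and>
      (\<forall>\<phi> \<in> cochains0 X m k. \<forall>\<mu>. upper_walk X m k \<phi> = fscale \<mu> \<phi> \<longrightarrow>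
         (\<forall>j \<le> k. \<mu> \<in> eps_interval l k j \<longrightarrow>
            cnorm X m k (\<phi> - orth_proj X m k (Usp X m k j) \<phi>)
              \<le> sqrt (real k + 1) * eps l k / (1 - sqrt (real k + 1) * eps l k) * cnorm X m k \<phi>))"
proof (intro allI impI)
  fix k assume "k \<le> n - 1"
  then have k: "k < n" "k \<le> n" using assms(1) by auto
  interpret weighted_complex X m n using assms by unfold_locales
  have lb: "local_bound l" using local_bound_of_expander assms(5) .
  have l: "0 \<le> l" using local_bound_nonneg lb assms(1) .
  have ap: "approx_spectrum (eps l k) k" using approx_spectrum_eps[OF lb assms(1,6) k(1)] .
  have e: "0 \<le> eps l k" using eps_nonneg[OF l] .
  have small: "sqrt (real k + 1) * eps l k < 1"
  proof (cases "k = n - 1")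
    case True
    then have "eps l k < 1 / (2 * sqrt (real k + 1))" using assms(1,7) by (simp add: of_nat_diff)
    then have "sqrt (real k + 1) * eps l k < 1 / 2" by (simp add: field_simps)
    then show ?thesis by simp
  next
    case False
    then show ?thesis using small_eps[of "eps l k" k] assms(6) k by force
  qed
  have eig: "lap (Suc k) \<phi> = fscale ((real k + 2) * \<mu>) \<phi>" if "upper_walk X m k \<phi> = fscale \<mu> \<phi>" for \<phi> \<mu>
    unfolding upper_walk_eq[OF k(1), symmetric] that by simp
  show "Spec (cochains X k) (upper_walk X m k) \<subseteq> {1} \<union> (\<Union>j\<in>{0..k}. eps_interval l k j) \<and>
      (\<forall>\<phi> \<in> cochains0 X m k. \<forall>\<mu>. upper_walk X m k \<phi> = fscale \<mu> \<phi> \<longrightarrow>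
         (\<forall>j \<le> k. \<mu> \<in> eps_interval l k j \<longrightarrow>
            cnorm X m k (\<phi> - orth_proj X m k (Usp X m k j) \<phi>)
              \<le> sqrt (real k + 1) * eps l k / (1 - sqrt (real k + 1) * eps l k) * cnorm X m k \<phi>))"
  proof (intro conjI subsetI ballI allI impI)
    fix \<mu> assume "\<mu> \<in> Spec (cochains X k) (upper_walk X m k)"
    then obtain \<phi> where \<phi>: "\<phi> \<in> cochains X k" "\<phi> \<noteq> 0" "upper_walk X m k \<phi> = fscale \<mu> \<phi>"
      by (auto simp: Spec_def)
    show "\<mu> \<in> {1} \<union> (\<Union>j\<in>{0..k}. eps_interval l k j)"
    proof (cases "\<mu> = 1")
      case False
      then have "(real k + 2) * \<mu> \<noteq> real k + 2" by simp
      then have "\<phi> \<in> cochains0 X m k"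
        using eigenvector_mean_zero[OF k(1) \<phi>(1) eig[OF \<phi>(3)]] by simp
      then obtain j where "j \<le> k" "\<mu> \<in> eps_interval l k j"
        using eigenvalue_near_integer[OF ap e k(2) _ \<phi>(2) eig[OF \<phi>(3)]] unfolding eps_interval_iff by blast
      then show ?thesis by auto
    qed simp
  next
    fix \<phi> \<mu> j assume "\<phi> \<in> cochains0 X m k" "upper_walk X m k \<phi> = fscale \<mu> \<phi>"
      "j \<le> k" "\<mu> \<in> eps_interval l k j"
    then show "cnorm X m k (\<phi> - orth_proj X m k (Usp X m k j) \<phi>)
        \<le> sqrt (real k + 1) * eps l k / (1 - sqrt (real k + 1) * eps l k) * cnorm X m k \<phi>"
      unfolding cnorm_eq eps_interval_iff by (intro eigenvector_near_component[OF ap e k(2) small _ eig])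
  qed
qed

end
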